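(* Let $\gamma\in(0,1)$ and $p_0=1/\gamma$. Let $\psi\in\Psi(1,p_0)$ and $\psi^{(\gamma)}(p)=K^{(\gamma)}(p)\,\psi(p)$ for $p\in(1,p_0)$. For every function $f(x)=\frac{a(0)}2+\sum_{k\ge1}[a(k)\cos kx+b(k)\sin kx]$ on $[-\pi,\pi]$ whose coefficient sequences $a(\cdot)$ and $b(\cdot)$ are both monotonically decreasing and whose combined coefficient sequence $\vec\lambda$ has $\|\vec\lambda\|_{G^{(\gamma)}\psi}<\infty$, the function $U_\gamma[f](x)=|x|^{-\gamma}f(x)$ satisfies $$\|U_\gamma[f]\|_{G\psi^{(\gamma)}}\le 1\cdot\|\vec\lambda\|_{G^{(\gamma)}\psi},$$ and the constant $1$ is best possible, i.e. the supremum of the ratio $\|U_\gamma[f]\|_{G\psi^{(\gamma)}}/\|\vec\lambda\|_{G^{(\gamma)}\psi}$ over all such $\psi\in\Psi(1,p_0)$ and all such $f$ with $\vec\lambda\neq0$ equals $1$.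
   Context: $[-\pi,\pi]$ carries Lebesgue measure and $|g|_p$ is the $L_p$ norm. $\vec\lambda$ is the sequence $\lambda(1)=a(0),\ \lambda(2)=b(1),\ \lambda(3)=a(1),\ \lambda(4)=b(2),\ \lambda(5)=a(2),\dots$. Put $$|\vec\lambda|^{(\gamma)}_p=\left[\sum_{n\ge1}n^{p(1+\gamma)-2}|\lambda(n)|^p\right]^{1/p},\qquad \|\vec\lambda\|_{G^{(\gamma)}\psi}=\sup_{p\in(1,p_0)}|\vec\lambda|^{(\gamma)}_p/\psi(p),$$ $$K^{(\gamma)}(p)=\sup\frac{|U_\gamma[f]|_p}{|\vec\lambda|^{(\gamma)}_p}\qquad(1<p<p_0),$$ the supremum being over all $\vec\lambda\ne0$ with $|\vec\lambda|_p^{(\gamma)}<\infty$ whose $a(\cdot)$ and $b(\cdot)$ are monotonically decreasing, $f$ being the corresponding sum; $K^{(\gamma)}(p)<\infty$ for $p\in(1,p_0)$. $\Psi(1,p_0)$ is the set of continuous positive functions $\psi$ on $(1,p_0)$ with positive infimum, and $\|g\|_{G\theta}=\sup_{p\in(1,p_0)}|g|_p/\theta(p)$. *)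

theory Defs
  imports "HOL-Analysis.Analysis"
begin

text \<open>All norms take values in \<^typ>\<open>ennreal\<close>, so that a divergent integral, series or
  supremum is \<open>\<infinity>\<close>.\<close>

(* Used only for exponents r > 0, so infinity is mapped to infinity. *)
definition ennreal_powr :: "ennreal \<Rightarrow> real \<Rightarrow> ennreal" where
  "ennreal_powr x r = (if x = \<infinity> then \<infinity> else ennreal (enn2real x powr r))"

definition Lp_norm :: "real \<Rightarrow> (real \<Rightarrow> real) \<Rightarrow> ennreal" where
  "Lp_norm p g =
     ennreal_powr (\<integral>\<^sup>+x. ennreal (\<bar>g x\<bar> powr p) \<partial>lebesgue_on {-pi..pi}) (1 / p)"

(* Here lambda(1) = a(0), lambda(2) = b(1), lambda(3) = a(1), ...; the sequence is indexed by
   n >= 1 and the entry at 0 is never used. *)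
definition coeff_seq :: "(nat \<Rightarrow> real) \<Rightarrow> (nat \<Rightarrow> real) \<Rightarrow> nat \<Rightarrow> real" where
  "coeff_seq a b n = (if odd n then a (n div 2) else b (n div 2))"

(* The sequence a is indexed by k >= 0, the sequence b by k >= 1; b 0 plays no role. *)
definition decreasing_coeffs :: "(nat \<Rightarrow> real) \<Rightarrow> (nat \<Rightarrow> real) \<Rightarrow> bool" where
  "decreasing_coeffs a b \<longleftrightarrow> decseq a \<and> antimono_on {1..} b"

(* For coefficients decreasing to 0 the series converges at every x of [-pi, pi] except
   possibly x = 0, a null set, where the value is immaterial for the L_p norms. Monotone
   coefficients with a finite weighted norm (below) do tend to 0, since the exponent
   p (1 + gamma) - 2 exceeds -1. *)
definition trig_sum :: "(nat \<Rightarrow> real) \<Rightarrow> (nat \<Rightarrow> real) \<Rightarrow> real \<Rightarrow> real" where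
  "trig_sum a b x =
     a 0 / 2 + (\<Sum>k. a (Suc k) * cos (real (Suc k) * x) + b (Suc k) * sin (real (Suc k) * x))"

definition U_op :: "real \<Rightarrow> (real \<Rightarrow> real) \<Rightarrow> real \<Rightarrow> real" where
  "U_op \<gamma> f x = \<bar>x\<bar> powr (- \<gamma>) * f x"

definition seq_norm :: "real \<Rightarrow> real \<Rightarrow> (nat \<Rightarrow> real) \<Rightarrow> ennreal" where
  "seq_norm \<gamma> p l =
     ennreal_powr
       (\<Sum>m. ennreal (real (Suc m) powr (p * (1 + \<gamma>) - 2) * \<bar>l (Suc m)\<bar> powr p)) (1 / p)"

definition K_const :: "real \<Rightarrow> real \<Rightarrow> ennreal" where
  "K_const \<gamma> p =
     (SUP (a, b) \<in> {(a, b). decreasing_coeffs a b \<and> (\<exists>n\<ge>1. coeff_seq a b n \<noteq> 0) \<and>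
                           seq_norm \<gamma> p (coeff_seq a b) < \<infinity>}.
        Lp_norm p (U_op \<gamma> (trig_sum a b)) / seq_norm \<gamma> p (coeff_seq a b))"

definition Psi_class :: "real \<Rightarrow> (real \<Rightarrow> real) set" where
  "Psi_class p0 =
     {\<psi>. continuous_on {1<..<p0} \<psi> \<and> (\<forall>p\<in>{1<..<p0}. 0 < \<psi> p) \<and> 0 < (INF p\<in>{1<..<p0}. \<psi> p)}"

definition grand_norm :: "real \<Rightarrow> (real \<Rightarrow> ennreal) \<Rightarrow> (real \<Rightarrow> real) \<Rightarrow> ennreal" where
  "grand_norm p0 \<theta> g = (SUP p\<in>{1<..<p0}. Lp_norm p g / \<theta> p)"

definition grand_seq_norm ::
    "real \<Rightarrow> real \<Rightarrow> (real \<Rightarrow> real) \<Rightarrow> (nat \<Rightarrow> real) \<Rightarrow> ennreal" where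
  "grand_seq_norm p0 \<gamma> \<psi> l = (SUP p\<in>{1<..<p0}. seq_norm \<gamma> p l / ennreal (\<psi> p))"

definition psi_gamma :: "real \<Rightarrow> (real \<Rightarrow> real) \<Rightarrow> real \<Rightarrow> ennreal" where
  "psi_gamma \<gamma> \<psi> p = K_const \<gamma> p * ennreal (\<psi> p)"

end

theory Submission
  imports Defs
begin

text \<open>The inequality holds for each \<open>p\<close> separately by the definition of \<open>K(p)\<close>. For its
  sharpness one needs \<open>0 < K(p) < \<infinity>\<close> at a single \<open>p\<close>, since otherwise the quotients
  defining the grand norm degenerate to \<open>0\<close>.

  Finiteness of \<open>K(p)\<close>: Abel summation gives \<open>\<bar>f(x)\<bar> \<le> 3 (\<lambda>(1) + \<dots> + \<lambda>(n))\<close> for \<open>n\<close> the integer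
  part of \<open>4 \<pi> / \<bar>x\<bar>\<close>, and summing over the shells on which \<open>n\<close> is constant leaves a weighted
  discrete Hardy inequality, with \<open>r = 2 - \<gamma> p > 1\<close>.

  Sharpness: by Fatou's lemma, \<open>K(p)\<close> is already the supremum over finitely supported
  coefficients. For such coefficients \<open>\<psi>(p) = |\<lambda>|\<^sub>p\<close> belongs to \<open>\<Psi>(1, p\<^sub>0)\<close>; with this
  \<open>\<psi>\<close> the sequence has grand norm \<open>1\<close>, and the ratio of the two grand norms is at least the
  ratio of the two norms at \<open>p\<close> divided by \<open>K(p)\<close>.\<close>

section \<open>Trigonometric series with decreasing coefficients\<close>

text \<open>Jordan's inequality: sine is concave on the quarter period, so its graph lies above the
  chord from (0, 0) to (pi/2, 1).\<close>

lemma jordan_sin_ge: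
  fixes y :: real
  assumes "0 \<le> y" "y \<le> pi / 2"
  shows "2 * y / pi \<le> sin y"
proof -
  have "concave_on {0..pi/2} sin"
  proof (rule f''_le0_imp_concave)
    show "DERIV sin x :> cos x" for x :: real by (rule DERIV_sin)
    show "DERIV cos x :> - sin x" for x :: real by (rule DERIV_cos)
    show "- sin x \<le> 0" if "x \<in> {0..pi/2}" for x
      using that sin_ge_zero[of x] by auto
  qed simp
  from concave_onD[OF this, of "2 * y / pi" 0 "pi / 2"] show ?thesis
    using assms by (simp add: field_simps)
qed

text \<open>The chord has length 2 |sin(x/2)|, and Jordan's inequality applies to |x|/2. This
  controls the denominator \<open>norm (1 - z)\<close> that Abel summation produces.\<close>

lemma dist_cis_one_ge:
  assumes "\<bar>x\<bar> \<le> pi"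
  shows "2 * \<bar>x\<bar> / pi \<le> norm (1 - cis x)"
proof -
  have "norm (1 - cis x) = 2 * \<bar>sin (x / 2)\<bar>"
    using dist_exp_i_1[of x] by (simp add: cis_conv_exp norm_minus_commute)
  also have "\<bar>sin (x / 2)\<bar> = \<bar>sin (\<bar>x\<bar> / 2)\<bar>"
    by (cases "x \<ge> 0") auto
  also have "2 * \<bar>sin (\<bar>x\<bar> / 2)\<bar> \<ge> 2 * (2 * (\<bar>x\<bar> / 2) / pi)"
    using jordan_sin_ge[of "\<bar>x\<bar> / 2"] assms by linarith
  finally show ?thesis by simp
qed

text \<open>Abel summation: after multiplication by 1 - z only two boundary terms and the
  differences of consecutive coefficients remain. The differences are nonnegative and telescope, so
  the bound involves the first coefficient alone.\<close>

lemma norm_sum_decseq_cis_le: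
  fixes c :: "nat \<Rightarrow> real" and z :: complex
  assumes dec: "decseq c" and nn: "\<And>k. 0 \<le> c k" and z: "norm z = 1" "z \<noteq> 1"
  shows "norm (\<Sum>k=m..<n. of_real (c k) * z ^ k) \<le> 2 * c m / norm (1 - z)"
proof (cases "m < n")
  case True
  \<comment> \<open>Summation by parts in multiplied form; the upper limit \<open>Suc i\<close>
    keeps the range nonempty and shows the last coefficient \<open>c i\<close>.\<close>
  have parts: "(1 - z) * (\<Sum>k=m..<Suc i. of_real (c k) * z ^ k)
      = of_real (c m) * z ^ m - of_real (c i) * z ^ Suc i
        - (\<Sum>k=m..<i. of_real (c k - c (Suc k)) * z ^ Suc k)" if "m \<le> i" for i
    using that
  proof (induction i rule: dec_induct)
    case base
    then show ?case by (simp add: algebra_simps)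
  next
    case (step i)
    have "(\<Sum>k=m..<Suc (Suc i). of_real (c k) * z ^ k)
        = (\<Sum>k=m..<Suc i. of_real (c k) * z ^ k) + of_real (c (Suc i)) * z ^ Suc i"
      using step(1) by (intro sum.atLeastLessThan_Suc) simp
    moreover have "(\<Sum>k=m..<Suc i. of_real (c k - c (Suc k)) * z ^ Suc k)
        = (\<Sum>k=m..<i. of_real (c k - c (Suc k)) * z ^ Suc k)
          + of_real (c i - c (Suc i)) * z ^ Suc i"
      using step(1) by (intro sum.atLeastLessThan_Suc) simp
    ultimately show ?case
      using step.IH by (simp only: distrib_left) (simp add: algebra_simps)
  qed
  obtain i where i: "n = Suc i" "m \<le> i" using True by (cases n) auto
  have "norm (\<Sum>k=m..<i. of_real (c k - c (Suc k)) * z ^ Suc k)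
      \<le> (\<Sum>k=m..<i. c k - c (Suc k))"
  proof (rule order_trans[OF norm_sum sum_mono])
    fix k
    have "c (Suc k) \<le> c k" using dec by (simp add: decseq_Suc_iff)
    then show "norm (of_real (c k - c (Suc k)) * z ^ Suc k) \<le> c k - c (Suc k)"
      using z by (simp only: norm_mult norm_power norm_of_real) simp
  qed
  also have "\<dots> = c m - c i"
    using sum_Suc_diff'[of m i "\<lambda>k. - c k"] i by simp
  finally have "norm ((1 - z) * (\<Sum>k=m..<n. of_real (c k) * z ^ k))
      \<le> norm (of_real (c m) * z ^ m :: complex) + norm (of_real (c i) * z ^ Suc i :: complex) + (c m - c i)"
    unfolding i parts[OF i(2)]
    by (rule order_trans[OF norm_triangle_ineq4 add_mono[OF norm_triangle_ineq4]])
  also have "\<dots> = 2 * c m"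
    using z nn[of m] nn[of i] by (simp add: norm_mult norm_power)
  finally have "norm (1 - z) * norm (\<Sum>k=m..<n. of_real (c k) * z ^ k) \<le> 2 * c m"
    by (simp only: norm_mult)
  moreover have "0 < norm (1 - z)" using z by simp
  ultimately show ?thesis
    by (simp only: pos_le_divide_eq mult.commute)
next
  case False
  then show ?thesis using nn[of m] by simp
qed

text \<open>Dirichlet's test: by the Abel bound every block starting at m is at most 2 c(m) / |1 -
  z|, uniformly in its length.\<close>

lemma summable_decseq_power_unit:
  fixes c :: "nat \<Rightarrow> real" and z :: complex
  assumes dec: "decseq c" and lim: "c \<longlonglongrightarrow> 0" and z: "norm z = 1" "z \<noteq> 1"
  shows "summable (\<lambda>k. of_real (c k) * z ^ k)"
  unfolding summable_Cauchy
proof (intro allI impI)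
  fix e :: real assume "0 < e"
  have "(\<lambda>m. 2 * c m / norm (1 - z)) \<longlonglongrightarrow> 2 * 0 / norm (1 - z)"
    using z by (intro tendsto_intros lim) auto
  with \<open>0 < e\<close> have "eventually (\<lambda>m. 2 * c m / norm (1 - z) < e) sequentially"
    by (auto intro: order_tendstoD)
  then obtain N where N: "\<And>m. m \<ge> N \<Longrightarrow> 2 * c m / norm (1 - z) < e"
    by (auto simp: eventually_sequentially)
  show "\<exists>N. \<forall>m\<ge>N. \<forall>n. norm (\<Sum>k=m..<n. of_real (c k) * z ^ k) < e"
  proof (intro exI allI impI)
    fix m n assume "N \<le> m"
    have nn: "\<And>k. 0 \<le> c k" using decseq_ge[OF dec lim] .
    from norm_sum_decseq_cis_le[OF dec nn z, of m n] N[OF \<open>N \<le> m\<close>]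
    show "norm (\<Sum>k=m..<n. of_real (c k) * z ^ k) < e" by linarith
  qed
qed

text \<open>The series is split after index n. The head is bounded term by term. The tail is at most
  c(n+1) pi/|x|, hence at most (n+1) c(n+1), which monotonicity bounds by the same head sum.\<close>

lemma norm_suminf_decseq_cis_le:
  fixes c :: "nat \<Rightarrow> real"
  assumes dec: "decseq c" and lim: "c \<longlonglongrightarrow> 0"
    and x: "x \<noteq> 0" "\<bar>x\<bar> \<le> pi" and n: "pi / \<bar>x\<bar> \<le> real n + 1"
  shows "norm (\<Sum>k. of_real (c k) * cis x ^ k) \<le> 2 * (\<Sum>k\<le>n. c k)"
proof -
  have nn: "\<And>k. 0 \<le> c k" using decseq_ge[OF dec lim] .
  have pos: "0 < 2 * \<bar>x\<bar> / pi" using x by simp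
  have z: "norm (cis x) = 1" "cis x \<noteq> 1"
    using dist_cis_one_ge[OF x(2)] pos by auto
  let ?t = "\<lambda>k. of_real (c k) * cis x ^ k"
  have "norm (\<Sum>k<M. ?t k) \<le> 2 * (\<Sum>k\<le>n. c k)" if "M \<ge> Suc n" for M
  proof -
    have "(\<Sum>k<M. ?t k) = (\<Sum>k<Suc n. ?t k) + (\<Sum>k=Suc n..<M. ?t k)"
      using sum.atLeastLessThan_concat[of 0 "Suc n" M ?t] that by (simp add: lessThan_atLeast0)
    moreover have "norm (\<Sum>k<Suc n. ?t k) \<le> (\<Sum>k<Suc n. c k)"
      by (rule sum_norm_le) (simp add: norm_mult norm_power nn)
    moreover have "norm (\<Sum>k=Suc n..<M. ?t k) \<le> (\<Sum>k<Suc n. c k)"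
    proof -
      have "norm (\<Sum>k=Suc n..<M. ?t k) \<le> 2 * c (Suc n) / norm (1 - cis x)"
        by (rule norm_sum_decseq_cis_le[OF dec nn z])
      also have "\<dots> \<le> 2 * c (Suc n) / (2 * \<bar>x\<bar> / pi)"
        using dist_cis_one_ge[OF x(2)] pos nn[of "Suc n"] by (intro divide_left_mono mult_pos_pos) auto
      also have "\<dots> = c (Suc n) * (pi / \<bar>x\<bar>)" by simp
      also have "\<dots> \<le> c (Suc n) * (real n + 1)"
        using n nn by (intro mult_left_mono) auto
      also have "\<dots> = (\<Sum>k<Suc n. c (Suc n))" by (simp add: algebra_simps)
      also have "\<dots> \<le> (\<Sum>k<Suc n. c k)"
        by (rule sum_mono) (use dec in \<open>auto simp: decseq_def\<close>)
      finally show ?thesis .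
    qed
    ultimately have "norm (\<Sum>k<M. ?t k) \<le> (\<Sum>k<Suc n. c k) + (\<Sum>k<Suc n. c k)"
      using norm_triangle_ineq[of "\<Sum>k<Suc n. ?t k" "\<Sum>k=Suc n..<M. ?t k"] by simp
    then show ?thesis by (simp add: lessThan_Suc_atMost)
  qed
  moreover have "(\<lambda>M. norm (\<Sum>k<M. ?t k)) \<longlonglongrightarrow> norm (suminf ?t)"
    by (intro tendsto_norm summable_LIMSEQ summable_decseq_power_unit dec lim z)
  ultimately show ?thesis
    by (intro LIMSEQ_le_const2) auto
qed

section \<open>A weighted discrete Hardy inequality\<close>

text \<open>Mean value theorem on a unit step; it compares power sums with telescoping sums in the
  next two lemmas.\<close>

lemma powr_diff_eq_deriv:
  fixes a s :: real
  assumes "0 < a"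
  obtains z where "a < z" "z < a + 1" "(a + 1) powr s - a powr s = s * z powr (s - 1)"
proof -
  have "\<exists>z>a. z < a + 1 \<and> (a + 1) powr s - a powr s = (a + 1 - a) * (s * z powr (s - 1))"
  proof (rule MVT2)
    fix x assume "a \<le> x"
    with assms show "((\<lambda>x. x powr s) has_real_derivative s * x powr (s - 1)) (at x)"
      by (intro has_real_derivative_powr) auto
  qed simp
  then show ?thesis using that by auto
qed

text \<open>Comparison with an integral: as t - 1 is not positive, each term after the first is at
  most the preceding increment of x^t / t, and the first term 1 is at most 1/t.\<close>

lemma sum_powr_le:
  fixes t :: real
  assumes t: "0 < t" "t \<le> 1"
  shows "(\<Sum>m\<le>n. real (Suc m) powr (t - 1)) \<le> real (Suc n) powr t / t"
proof (induction n)
  case 0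
  then show ?case using t by simp
next
  case (Suc n)
  obtain z where z: "real (Suc n) < z" "z < real (Suc n) + 1"
      "(real (Suc n) + 1) powr t - real (Suc n) powr t = t * z powr (t - 1)"
    by (rule powr_diff_eq_deriv[of "real (Suc n)" t]) simp
  have "real (Suc (Suc n)) powr (t - 1) \<le> z powr (t - 1)"
    using z t by (intro powr_mono2') auto
  then have "t * real (Suc (Suc n)) powr (t - 1) \<le> t * z powr (t - 1)"
    using t by (intro mult_left_mono) auto
  also have "\<dots> = real (Suc (Suc n)) powr t - real (Suc n) powr t"
    using z(3) by (simp add: add.commute)
  finally have "real (Suc (Suc n)) powr (t - 1)
      \<le> real (Suc (Suc n)) powr t / t - real (Suc n) powr t / t"
    using t by (simp add: field_simps)
  then show ?case using Suc by simp
qed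

text \<open>The first term is at most (m+1)^(-u), and the later ones are dominated by increments
  that telescope to at most (m+1)^(-u) / u. This gives the two summands of 1 + 1/u, uniformly in
  N.\<close>

lemma sum_powr_tail_le:
  fixes u :: real
  assumes u: "0 < u"
  shows "(\<Sum>n=m..<N. real (Suc n) powr (- u - 1)) \<le> (1 + 1 / u) * real (Suc m) powr (- u)"
proof -
  have gap: "real (Suc (Suc n)) powr (- u - 1)
      \<le> (real (Suc n) powr (- u) - real (Suc (Suc n)) powr (- u)) / u" for n
  proof -
    obtain z where z: "real (Suc n) < z" "z < real (Suc n) + 1"
        "(real (Suc n) + 1) powr (- u) - real (Suc n) powr (- u) = - u * z powr (- u - 1)"
      by (rule powr_diff_eq_deriv[of "real (Suc n)" "- u"]) simp
    have "real (Suc (Suc n)) powr (- u - 1) \<le> z powr (- u - 1)"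
      using z u by (intro powr_mono2') auto
    also have "\<dots> = (real (Suc n) powr (- u) - real (Suc (Suc n)) powr (- u)) / u"
      using z(3) u by (simp add: field_simps add.commute)
    finally show ?thesis .
  qed
  have "(\<Sum>n=m..<Suc N. real (Suc n) powr (- u - 1))
      \<le> real (Suc m) powr (- u) + (real (Suc m) powr (- u) - real (Suc N) powr (- u)) / u"
    if "m \<le> N" for N
    using that
  proof (induction N rule: dec_induct)
    case base
    show ?case using u by (simp add: powr_mono)
  next
    case (step N)
    then show ?case
      using gap[of N] by (simp add: diff_divide_distrib)
  qed
  note bound = this
  show ?thesis
  proof (cases "m < N")
    case True
    then obtain M where M: "N = Suc M" "m \<le> M" by (cases N) auto
    have "(\<Sum>n=m..<N. real (Suc n) powr (- u - 1))
      \<le> real (Suc m) powr (- u) + (real (Suc m) powr (- u) - real (Suc M) powr (- u)) / u"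
      using bound[OF M(2)] M(1) by simp
    also have "\<dots> \<le> real (Suc m) powr (- u) + real (Suc m) powr (- u) / u"
      using u by (intro add_left_mono divide_right_mono) auto
    finally show ?thesis by (simp add: algebra_simps)
  qed (use u in auto)
qed

text \<open>Jensen's inequality for the convex function y^p at the points W x(i) / w(i) with weights
  w(i) / W, where W is the total weight.\<close>

lemma sum_powr_le_weighted:
  fixes x w :: "'a \<Rightarrow> real"
  assumes p: "1 \<le> p" and fin: "finite A"
    and x: "\<And>i. i \<in> A \<Longrightarrow> 0 \<le> x i" and w: "\<And>i. i \<in> A \<Longrightarrow> 0 < w i"
  shows "(\<Sum>i\<in>A. x i) powr p
    \<le> (\<Sum>i\<in>A. w i) powr (p - 1) * (\<Sum>i\<in>A. w i powr (1 - p) * x i powr p)"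
proof -
  \<comment> \<open>Jensen's inequality is only available for \<open>powr\<close> on the open half line, so the zero
    terms are removed first.\<close>
  define S where "S = {i\<in>A. 0 < x i}"
  have S: "finite S" "S \<subseteq> A" "\<And>i. i \<in> S \<Longrightarrow> 0 < x i" "\<And>i. i \<in> A - S \<Longrightarrow> x i = 0"
    using fin x by (auto simp: S_def) (meson antisym not_less)
  show ?thesis
  proof (cases "S = {}")
    case True
    then have "(\<Sum>i\<in>A. x i) = 0" using S by (intro sum.neutral) auto
    then show ?thesis by (simp add: sum_nonneg)
  next
    case False
    define W where "W = (\<Sum>i\<in>S. w i)"
    have W: "0 < W" unfolding W_def using S w False by (intro sum_pos) auto
    have "(\<Sum>i\<in>S. (w i / W) *\<^sub>R (W * x i / w i)) powr p
        \<le> (\<Sum>i\<in>S. (w i / W) * (W * x i / w i) powr p)"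
    proof (rule convex_on_sum[OF S(1) False powr_convex[OF p]])
      show "(\<Sum>i\<in>S. w i / W) = 1"
        using W by (simp add: W_def flip: sum_divide_distrib)
      show "0 \<le> w i / W" if "i \<in> S" for i using W w that S by (intro divide_nonneg_pos) (auto intro: less_imp_le)
      show "W * x i / w i \<in> {0<..}" if "i \<in> S" for i using W w that S by auto
    qed
    also have "(\<Sum>i\<in>S. (w i / W) *\<^sub>R (W * x i / w i)) = (\<Sum>i\<in>S. x i)"
    proof (rule sum.cong)
      fix i assume "i \<in> S"
      then have "w i \<noteq> 0" using w S by force
      then show "(w i / W) *\<^sub>R (W * x i / w i) = x i" using W by simp
    qed simp
    also have "(\<Sum>i\<in>S. x i) = (\<Sum>i\<in>A. x i)"
      using fin S by (intro sum.mono_neutral_left) auto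
    also have "(\<Sum>i\<in>S. (w i / W) * (W * x i / w i) powr p)
        = (\<Sum>i\<in>S. W powr (p - 1) * (w i powr (1 - p) * x i powr p))"
    proof (rule sum.cong)
      fix i assume "i \<in> S"
      then have "0 < w i" "0 < x i" using w S by auto
      then show "w i / W * (W * x i / w i) powr p = W powr (p - 1) * (w i powr (1 - p) * x i powr p)"
        using W by (simp add: powr_mult powr_divide powr_diff)
    qed simp
    also have "\<dots> = W powr (p - 1) * (\<Sum>i\<in>S. w i powr (1 - p) * x i powr p)"
      by (simp add: sum_distrib_left)
    also have "\<dots> \<le> (\<Sum>i\<in>A. w i) powr (p - 1) * (\<Sum>i\<in>A. w i powr (1 - p) * x i powr p)"
    proof (rule mult_mono)
      have "W \<le> (\<Sum>i\<in>A. w i)" unfolding W_def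
        using fin S w by (intro sum_mono2) (auto intro: less_imp_le)
      then show "W powr (p - 1) \<le> (\<Sum>i\<in>A. w i) powr (p - 1)"
        using W p by (intro powr_mono2) auto
      show "(\<Sum>i\<in>S. w i powr (1 - p) * x i powr p) \<le> (\<Sum>i\<in>A. w i powr (1 - p) * x i powr p)"
        using fin S by (intro sum_mono2) auto
    qed (auto intro!: sum_nonneg)
    finally show ?thesis .
  qed
qed

lemma sum_triangle_swap:
  fixes f :: "nat \<Rightarrow> nat \<Rightarrow> 'a::comm_monoid_add"
  shows "(\<Sum>n<N. \<Sum>m\<le>n. f n m) = (\<Sum>m<N. \<Sum>n=m..<N. f n m)"
proof (induction N)
  case (Suc N)
  have "(\<Sum>m<Suc N. \<Sum>n=m..<Suc N. f n m) = (\<Sum>m<N. (\<Sum>n=m..<N. f n m) + f N m) + f N N"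
    by simp
  also have "\<dots> = (\<Sum>m<N. \<Sum>n=m..<N. f n m) + ((\<Sum>m<N. f N m) + f N N)"
    by (simp only: sum.distrib add.assoc)
  also have "(\<Sum>m<N. f N m) + f N N = (\<Sum>m\<le>N. f N m)"
    by (simp only: lessThan_Suc_atMost[symmetric] sum.lessThan_Suc)
  finally show ?case using Suc by simp
qed simp

lemma weighted_hardy_finite:
  fixes p r :: real
  assumes p: "1 < p" and r: "1 < r"
  shows "\<exists>C>0. \<forall>x N. (\<forall>m. 0 \<le> x m) \<longrightarrow>
      (\<Sum>n<N. real (Suc n) powr (- r) * (\<Sum>m\<le>n. x m) powr p)
        \<le> C * (\<Sum>m<N. real (Suc m) powr (p - r) * x m powr p)"
proof -
  \<comment> \<open>Jensen's inequality with weights \<open>m powr (t - 1)\<close>; the bound on \<open>t\<close> makes the sums over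
    \<open>n\<close> converge after the order of summation is exchanged.\<close>
  define t where "t = min (1/2) ((r - 1) / (2 * (p - 1)))"
  have t: "0 < t" "t \<le> 1" using p r by (auto simp: t_def)
  have "t * (p - 1) \<le> (r - 1) / (2 * (p - 1)) * (p - 1)"
    using p by (intro mult_right_mono) (auto simp: t_def)
  also have "\<dots> = (r - 1) / 2" using p by (simp add: field_simps)
  also have "\<dots> < r - 1" using r by simp
  finally have tp: "t * (p - 1) < r - 1" .
  \<comment> \<open>The decay left over: the weights contribute the power t (p - 1) of n + 1, and -r
    + t (p - 1) = -u - 1.\<close>
  define u where "u = r - 1 - t * (p - 1)"
  have u: "0 < u" using tp by (simp add: u_def)
  define C where "C = t powr (1 - p) * (1 + 1 / u)"
  show ?thesis
  proof (intro exI conjI allI impI)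
    show "0 < C" using t u by (simp add: C_def add_pos_pos)
    fix x :: "nat \<Rightarrow> real" and N
    assume "\<forall>m. 0 \<le> x m"
    then have x: "0 \<le> x m" for m by blast
    \<comment> \<open>The terms on the right of Jensen's inequality, with the weight m^(t - 1)
      raised to the power 1 - p.\<close>
    define v where "v = (\<lambda>m. real (Suc m) powr ((1 - t) * (p - 1)) * x m powr p)"
    have v: "0 \<le> v m" for m by (simp add: v_def)
    have summand: "real (Suc n) powr (- r) * (\<Sum>m\<le>n. x m) powr p
        \<le> (\<Sum>m\<le>n. t powr (1 - p) * (real (Suc n) powr (- u - 1) * v m))" for n
    proof -
      have "(\<Sum>m\<le>n. x m) powr p \<le> (\<Sum>m\<le>n. real (Suc m) powr (t - 1)) powr (p - 1)
          * (\<Sum>m\<le>n. (real (Suc m) powr (t - 1)) powr (1 - p) * x m powr p)"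
        using p x by (intro sum_powr_le_weighted) auto
      also have "(\<Sum>m\<le>n. (real (Suc m) powr (t - 1)) powr (1 - p) * x m powr p) = (\<Sum>m\<le>n. v m)"
        by (simp add: v_def powr_powr algebra_simps)
      also have "(\<Sum>m\<le>n. real (Suc m) powr (t - 1)) powr (p - 1) * (\<Sum>m\<le>n. v m)
          \<le> (real (Suc n) powr t / t) powr (p - 1) * (\<Sum>m\<le>n. v m)"
        using sum_powr_le[OF t, of n] p
        by (intro mult_right_mono powr_mono2 sum_nonneg v) auto
      also have "(real (Suc n) powr t / t) powr (p - 1)
          = t powr (1 - p) * real (Suc n) powr (t * (p - 1))"
        using t powr_minus_divide[of t "p - 1"] by (simp add: powr_divide powr_powr)
      finally have "real (Suc n) powr (- r) * (\<Sum>m\<le>n. x m) powr p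
        \<le> real (Suc n) powr (- r) * (t powr (1 - p) * real (Suc n) powr (t * (p - 1)) * (\<Sum>m\<le>n. v m))"
        by (intro mult_left_mono) auto
      also have "\<dots> = t powr (1 - p) * ((real (Suc n) powr (- r) * real (Suc n) powr (t * (p - 1))) * (\<Sum>m\<le>n. v m))"
        by (simp only: mult_ac)
      also have "real (Suc n) powr (- r) * real (Suc n) powr (t * (p - 1)) = real (Suc n) powr (- u - 1)"
        by (simp add: u_def flip: powr_add)
      finally show ?thesis by (simp add: sum_distrib_left)
    qed
    have "(\<Sum>n<N. real (Suc n) powr (- r) * (\<Sum>m\<le>n. x m) powr p)
        \<le> (\<Sum>n<N. \<Sum>m\<le>n. t powr (1 - p) * (real (Suc n) powr (- u - 1) * v m))"
      by (intro sum_mono summand)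
    \<comment> \<open>After the interchange the sum over n is a tail starting at m, which costs only
      the factor (m+1)^(-u) up to a constant.\<close>
    also have "\<dots> = (\<Sum>m<N. t powr (1 - p) * (v m * (\<Sum>n=m..<N. real (Suc n) powr (- u - 1))))"
      by (simp add: sum_triangle_swap sum_distrib_left mult.commute)
    also have "\<dots> \<le> (\<Sum>m<N. t powr (1 - p) * (v m * ((1 + 1 / u) * real (Suc m) powr (- u))))"
      by (intro sum_mono mult_left_mono sum_powr_tail_le u v) auto
    also have "\<dots> = (\<Sum>m<N. C * (real (Suc m) powr (p - r) * x m powr p))"
    proof (rule sum.cong)
      fix m
      \<comment> \<open>The exponents add up: (1 - t) (p - 1) - u = p - r, so the auxiliary t
        disappears from the weight.\<close>
      have "real (Suc m) powr (p - r) = real (Suc m) powr ((1 - t) * (p - 1)) * real (Suc m) powr (- u)"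
        by (simp add: u_def algebra_simps flip: powr_add)
      then show "t powr (1 - p) * (v m * ((1 + 1 / u) * real (Suc m) powr (- u)))
          = C * (real (Suc m) powr (p - r) * x m powr p)"
        by (simp only: C_def v_def mult_ac)
    qed simp
    finally show "(\<Sum>n<N. real (Suc n) powr (- r) * (\<Sum>m\<le>n. x m) powr p)
        \<le> C * (\<Sum>m<N. real (Suc m) powr (p - r) * x m powr p)"
      by (simp only: sum_distrib_left)
  qed
qed

text \<open>The constant of the finite version does not depend on N, so the partial sums on the left
  can be bounded by the full series on the right, whether or not it converges.\<close>

lemma weighted_hardy:
  fixes p r :: real
  assumes p: "1 < p" and r: "1 < r"
  shows "\<exists>C>0. \<forall>x. (\<forall>m. 0 \<le> x m) \<longrightarrow>
      (\<Sum>n. ennreal (real (Suc n) powr (- r) * (\<Sum>m\<le>n. x m) powr p))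
        \<le> ennreal C * (\<Sum>m. ennreal (real (Suc m) powr (p - r) * x m powr p))"
proof -
  obtain C where C: "0 < C" "\<And>x N. \<forall>m. 0 \<le> x m \<Longrightarrow>
      (\<Sum>n<N. real (Suc n) powr (- r) * (\<Sum>m\<le>n. x m) powr p)
        \<le> C * (\<Sum>m<N. real (Suc m) powr (p - r) * x m powr p)"
    using weighted_hardy_finite[OF p r] by blast
  have "(\<Sum>n. ennreal (real (Suc n) powr (- r) * (\<Sum>m\<le>n. x m) powr p))
        \<le> ennreal C * (\<Sum>m. ennreal (real (Suc m) powr (p - r) * x m powr p))"
    if x: "\<forall>m. 0 \<le> x m" for x :: "nat \<Rightarrow> real"
  proof (rule suminf_le_const[OF summableI])
    fix N
    have "(\<Sum>n<N. ennreal (real (Suc n) powr (- r) * (\<Sum>m\<le>n. x m) powr p))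
        = ennreal (\<Sum>n<N. real (Suc n) powr (- r) * (\<Sum>m\<le>n. x m) powr p)"
      by (intro sum_ennreal) auto
    also have "\<dots> \<le> ennreal (C * (\<Sum>m<N. real (Suc m) powr (p - r) * x m powr p))"
      using C(2)[OF x] by (rule ennreal_leI)
    also have "\<dots> = ennreal C * (\<Sum>m<N. ennreal (real (Suc m) powr (p - r) * x m powr p))"
      using C(1) by (subst sum_ennreal) (auto simp: ennreal_mult sum_nonneg)
    also have "\<dots> \<le> ennreal C * (\<Sum>m. ennreal (real (Suc m) powr (p - r) * x m powr p))"
      by (intro mult_left_mono sum_le_suminf) auto
    finally show "(\<Sum>n<N. ennreal (real (Suc n) powr (- r) * (\<Sum>m\<le>n. x m) powr p))
        \<le> ennreal C * (\<Sum>m. ennreal (real (Suc m) powr (p - r) * x m powr p))" .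
  qed
  with C(1) show ?thesis by blast
qed

section \<open>Finiteness of the constant\<close>

text \<open>De Moivre: cosines and sines are real and imaginary parts of powers of
  \<open>cis x\<close>. The cosine series starts at index 1, hence the correction by a(0); the shift
  in the sine series produces the factor \<open>cis x\<close>.\<close>

lemma trig_series_eq_cis:
  fixes a b :: "nat \<Rightarrow> real"
  assumes a: "decseq a" "a \<longlonglongrightarrow> 0"
    and b: "decseq (\<lambda>k. b (Suc k))" "(\<lambda>k. b (Suc k)) \<longlonglongrightarrow> 0"
    and x: "x \<noteq> 0" "\<bar>x\<bar> \<le> pi"
  shows "(\<lambda>k. a (Suc k) * cos (real (Suc k) * x) + b (Suc k) * sin (real (Suc k) * x)) sums
    (Re (\<Sum>k. of_real (a k) * cis x ^ k) - a 0 + Im (cis x * (\<Sum>k. of_real (b (Suc k)) * cis x ^ k)))"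
proof (rule sums_add)
  have "0 < 2 * \<bar>x\<bar> / pi" using x by simp
  then have z: "norm (cis x) = 1" "cis x \<noteq> 1"
    using dist_cis_one_ge[OF x(2)] by auto
  have Re: "Re (of_real c * cis x ^ k) = c * cos (real k * x)"
    and Im: "Im (of_real c * cis x ^ k) = c * sin (real k * x)" for c k
    unfolding Complex.DeMoivre by simp_all
  have "(\<lambda>k. of_real (a k) * cis x ^ k) sums (\<Sum>k. of_real (a k) * cis x ^ k)"
    by (intro summable_sums summable_decseq_power_unit a z)
  from sums_Re[OF this] have "(\<lambda>k. a k * cos (real k * x)) sums Re (\<Sum>k. of_real (a k) * cis x ^ k)"
    by (simp only: Re)
  then show "(\<lambda>k. a (Suc k) * cos (real (Suc k) * x)) sums (Re (\<Sum>k. of_real (a k) * cis x ^ k) - a 0)"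
    by (subst sums_Suc_iff) simp
  have "(\<lambda>k. cis x * (of_real (b (Suc k)) * cis x ^ k)) sums
      (cis x * (\<Sum>k. of_real (b (Suc k)) * cis x ^ k))"
    by (intro sums_mult summable_sums summable_decseq_power_unit b z)
  also have "(\<lambda>k. cis x * (of_real (b (Suc k)) * cis x ^ k)) = (\<lambda>k. of_real (b (Suc k)) * cis x ^ Suc k)"
    by (simp add: mult_ac)
  finally show "(\<lambda>k. b (Suc k) * sin (real (Suc k) * x)) sums
      Im (cis x * (\<Sum>k. of_real (b (Suc k)) * cis x ^ k))"
    by (drule_tac sums_Im) (simp only: Im)
qed

lemma sum_coeff_seq:
  "(\<Sum>m<2 * j. coeff_seq a b (Suc m)) = (\<Sum>k<j. a k) + (\<Sum>k<j. b (Suc k))"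
  by (induction j) (simp_all add: coeff_seq_def)

lemma coeff_seq_nonneg:
  assumes "\<And>k. 0 \<le> a k" "\<And>k. 0 \<le> b (Suc k)"
  shows "0 \<le> coeff_seq a b (Suc m)"
proof (cases "even m")
  case False
  then obtain j where "m = Suc (2 * j)" by (auto elim: oddE)
  then show ?thesis using assms(2)[of j] by (simp add: coeff_seq_def)
qed (use assms(1) in \<open>simp add: coeff_seq_def\<close>)

text \<open>Both power series are cut at the integer part j of pi/|x|. The head sums over a(0), ...,
  a(j) and b(1), ..., b(j+1) together are exactly the sum of the first 2 (j+1) entries of the
  combined sequence.\<close>

lemma abs_trig_sum_le:
  fixes a b :: "nat \<Rightarrow> real"
  assumes a: "decseq a" "a \<longlonglongrightarrow> 0"
    and b: "decseq (\<lambda>k. b (Suc k))" "(\<lambda>k. b (Suc k)) \<longlonglongrightarrow> 0"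
    and x: "x \<noteq> 0" "\<bar>x\<bar> \<le> pi"
    and n: "4 * pi / \<bar>x\<bar> < real n + 1"
  shows "\<bar>trig_sum a b x\<bar> \<le> 3 * (\<Sum>m<n. coeff_seq a b (Suc m))"
proof -
  have a0: "\<And>k. 0 \<le> a k" and b0: "\<And>k. 0 \<le> b (Suc k)"
    using decseq_ge[OF a] decseq_ge[OF b] by auto
  define j where "j = nat \<lfloor>pi / \<bar>x\<bar>\<rfloor>"
  have "1 \<le> pi / \<bar>x\<bar>" using x by simp
  then have j: "real j \<le> pi / \<bar>x\<bar>" "pi / \<bar>x\<bar> < real j + 1"
    unfolding j_def by linarith+
  \<comment> \<open>The factor 4 comes from 2 (j+1) <= 2 pi/|x| + 2 <= 4 pi/|x|, where the last step
    uses |x| <= pi.\<close>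
  have "4 * (pi / \<bar>x\<bar>) < real n + 1" using n by simp
  with j \<open>1 \<le> pi / \<bar>x\<bar>\<close> have "real (2 * Suc j) < real (n + 1)" by simp
  then have jn: "2 * Suc j \<le> n" by linarith
  let ?A = "\<Sum>k. of_real (a k) * cis x ^ k" and ?B = "\<Sum>k. of_real (b (Suc k)) * cis x ^ k"
  have A: "norm ?A \<le> 2 * (\<Sum>k\<le>j. a k)"
    using j by (intro norm_suminf_decseq_cis_le a x) simp
  have B: "norm (cis x * ?B) \<le> 2 * (\<Sum>k\<le>j. b (Suc k))"
    using j norm_suminf_decseq_cis_le[OF b x, of j] by (simp add: norm_mult)
  have "trig_sum a b x = Re ?A - a 0 / 2 + Im (cis x * ?B)"
    using sums_unique[OF trig_series_eq_cis[OF a b x]] unfolding trig_sum_def by linarith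
  moreover have "a 0 \<le> (\<Sum>k\<le>j. a k)"
    using a0 by (intro member_le_sum) auto
  \<comment> \<open>Each series contributes the factor 2; the third unit in front of the first sum
    absorbs a(0)/2.\<close>
  ultimately have "\<bar>trig_sum a b x\<bar> \<le> 3 * (\<Sum>k\<le>j. a k) + 2 * (\<Sum>k\<le>j. b (Suc k))"
    using abs_Re_le_cmod[of ?A] abs_Im_le_cmod[of "cis x * ?B"] a0[of 0] A B by linarith
  moreover have "(\<Sum>k\<le>j. a k) + (\<Sum>k\<le>j. b (Suc k)) \<le> (\<Sum>m<n. coeff_seq a b (Suc m))"
  proof -
    have "(\<Sum>k\<le>j. a k) + (\<Sum>k\<le>j. b (Suc k)) = (\<Sum>m<2 * Suc j. coeff_seq a b (Suc m))"
      unfolding sum_coeff_seq lessThan_Suc_atMost ..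
    also have "\<dots> \<le> (\<Sum>m<n. coeff_seq a b (Suc m))"
      using jn by (intro sum_mono2 coeff_seq_nonneg a0 b0) auto
    finally show ?thesis .
  qed
  moreover have "0 \<le> (\<Sum>k\<le>j. b (Suc k))"
    using b0 by (intro sum_nonneg)
  ultimately show ?thesis by linarith
qed

text \<open>On the shell |x| ~ 4 pi/i the integrand is at most a constant times i^(\<gamma> p) times
  the p-th power of a partial sum, and the shell has measure of order i^(-2). This is the left side
  of Hardy's inequality with r = 2 - \<gamma> p; the weight on its right has exponent p - r = p (1 +
  \<gamma>) - 2, that of the sequence norm.\<close>

lemma integral_abs_U_op_powr_le:
  fixes \<gamma> p :: real
  assumes \<gamma>: "0 < \<gamma>" and p: "1 < p" and \<gamma>p: "\<gamma> * p < 1"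
  shows "\<exists>C>0. \<forall>a b. decseq a \<longrightarrow> a \<longlonglongrightarrow> 0 \<longrightarrow>
      decseq (\<lambda>k. b (Suc k)) \<longrightarrow> (\<lambda>k. b (Suc k)) \<longlonglongrightarrow> 0 \<longrightarrow>
      (\<integral>\<^sup>+x. ennreal (\<bar>U_op \<gamma> (trig_sum a b) x\<bar> powr p) \<partial>lebesgue_on {-pi..pi})
        \<le> ennreal C * (\<Sum>m. ennreal (real (Suc m) powr (p * (1 + \<gamma>) - 2) * \<bar>coeff_seq a b (Suc m)\<bar> powr p))"
proof -
  have r: "1 < 2 - \<gamma> * p" using \<gamma>p by simp
  obtain H where H: "0 < H" "\<And>x. \<forall>m. 0 \<le> x m \<Longrightarrow>
      (\<Sum>n. ennreal (real (Suc n) powr (- (2 - \<gamma> * p)) * (\<Sum>m\<le>n. x m) powr p))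
        \<le> ennreal H * (\<Sum>m. ennreal (real (Suc m) powr (p - (2 - \<gamma> * p)) * x m powr p))"
    using weighted_hardy[OF p r] by blast
  define D where "D = 2 powr (\<gamma> * p) * 3 powr p * (8 * pi)"
  have D: "0 < D" by (simp add: D_def)
  show ?thesis
  proof (intro exI conjI allI impI)
    show "0 < D * H" using D H(1) by simp
    fix a b :: "nat \<Rightarrow> real"
    assume a: "decseq a" "a \<longlonglongrightarrow> 0"
      and b: "decseq (\<lambda>k. b (Suc k))" "(\<lambda>k. b (Suc k)) \<longlonglongrightarrow> 0"
    define l where "l = (\<lambda>m. coeff_seq a b (Suc m))"
    have l: "0 \<le> l m" for m
      unfolding l_def using decseq_ge[OF a] decseq_ge[OF b] by (intro coeff_seq_nonneg) auto
    \<comment> \<open>Radii of the shells. The shells share endpoints and the first ones reach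
      beyond [-pi, pi]; both are harmless for an upper bound.\<close>
    define s where "s = (\<lambda>i. 4 * pi / real (Suc i))"
    define E where "E = (\<lambda>i. {s (Suc i)..s i} \<union> {- s i..- s (Suc i)})"
    define c where "c = (\<lambda>i. 2 powr (\<gamma> * p) * 3 powr p * (real (Suc i) powr (\<gamma> * p) * (\<Sum>m\<le>i. l m) powr p))"
    have s_dec: "s (Suc i) \<le> s i" for i by (simp add: s_def frac_le)
    have E: "E i \<in> sets lebesgue" for i by (simp add: E_def)
    have emeasure_E: "emeasure lebesgue (E i) \<le> ennreal (8 * pi * real (Suc i) powr (- 2))" for i
    proof -
      have "emeasure lebesgue (E i) \<le> ennreal (s i - s (Suc i)) + ennreal (s i - s (Suc i))"
        unfolding E_def using s_dec[of i]
        by (intro order_trans[OF emeasure_subadditive]) auto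
      also have "\<dots> = ennreal (2 * (s i - s (Suc i)))"
        using s_dec[of i] by (simp flip: ennreal_plus)
      also have "\<dots> \<le> ennreal (8 * pi * real (Suc i) powr (- 2))"
      proof (rule ennreal_leI)
        have "2 * (s i - s (Suc i)) = 8 * pi / (real (Suc i) * real (Suc (Suc i)))"
          by (simp add: s_def field_simps)
        also have "\<dots> \<le> 8 * pi / (real (Suc i) * real (Suc i))"
          by (intro divide_left_mono mult_left_mono mult_pos_pos) auto
        also have "\<dots> = 8 * pi * real (Suc i) powr (- 2)"
          by (simp add: powr_minus powr_numeral power2_eq_square divide_inverse)
        finally show "2 * (s i - s (Suc i)) \<le> 8 * pi * real (Suc i) powr (- 2)" .
      qed
      finally show ?thesis .
    qed
    have pointwise: "ennreal (\<bar>U_op \<gamma> (trig_sum a b) x\<bar> powr p) * indicator {-pi..pi} x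
        \<le> (\<Sum>i. ennreal (c i) * indicator (E i) x)" for x
    proof (cases "x \<noteq> 0 \<and> \<bar>x\<bar> \<le> pi")
      case True
      then have x: "x \<noteq> 0" "\<bar>x\<bar> \<le> pi" by auto
      \<comment> \<open>Shells are numbered from 0, so \<open>Suc i\<close> is the integer part; it
        is at least 4, so the subtraction is not truncated.\<close>
      define i where "i = nat \<lfloor>4 * pi / \<bar>x\<bar>\<rfloor> - 1"
      have "4 \<le> 4 * pi / \<bar>x\<bar>" using x by (simp add: field_simps)
      then have i: "real (Suc i) \<le> 4 * pi / \<bar>x\<bar>" "4 * pi / \<bar>x\<bar> < real (Suc i) + 1"
        unfolding i_def by linarith+
      have ix: "s (Suc i) \<le> \<bar>x\<bar>" "\<bar>x\<bar> \<le> s i"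
        using i x by (auto simp: s_def field_simps)
      then have "x \<in> E i" unfolding E_def by auto
      have "\<bar>x\<bar> powr (- \<gamma>) \<le> s (Suc i) powr (- \<gamma>)"
        using ix \<gamma> by (intro powr_mono2') (auto simp: s_def)
      \<comment> \<open>A crude lower bound for the inner radius, chosen so that the power involves
        i + 1 instead of i + 2.\<close>
      also have "\<dots> \<le> (1 / (2 * real (Suc i))) powr (- \<gamma>)"
      proof (rule powr_mono2')
        have "1 / (2 * real (Suc i)) \<le> 1 / real (Suc (Suc i))" by (intro divide_left_mono) auto
        also have "\<dots> \<le> s (Suc i)"
          using pi_gt3 by (auto simp: s_def intro!: divide_right_mono)
        finally show "1 / (2 * real (Suc i)) \<le> s (Suc i)" .
      qed (use \<gamma> in auto)
      also have "\<dots> = (2 * real (Suc i)) powr \<gamma>"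
        by (simp add: powr_minus powr_divide)
      finally have "\<bar>x\<bar> powr (- \<gamma>) \<le> (2 * real (Suc i)) powr \<gamma>" .
      moreover have "\<bar>trig_sum a b x\<bar> \<le> 3 * (\<Sum>m\<le>i. l m)"
        using abs_trig_sum_le[OF a b x, of "Suc i"] i by (simp add: l_def lessThan_Suc_atMost)
      ultimately have "\<bar>U_op \<gamma> (trig_sum a b) x\<bar> \<le> (2 * real (Suc i)) powr \<gamma> * (3 * (\<Sum>m\<le>i. l m))"
        unfolding U_op_def abs_mult by (intro mult_mono) auto
      then have "\<bar>U_op \<gamma> (trig_sum a b) x\<bar> powr p \<le> ((2 * real (Suc i)) powr \<gamma> * (3 * (\<Sum>m\<le>i. l m))) powr p"
        using p by (intro powr_mono2) auto
      also have "\<dots> = c i"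
        by (simp only: c_def powr_mult powr_powr mult_ac)
      finally have "ennreal (\<bar>U_op \<gamma> (trig_sum a b) x\<bar> powr p) * indicator {-pi..pi} x \<le> ennreal (c i) * indicator (E i) x"
        using \<open>x \<in> E i\<close> x by (auto simp: ennreal_leI indicator_def)
      also have "\<dots> = (\<Sum>i\<in>{i}. ennreal (c i) * indicator (E i) x)"
        by (simp only: sum.insert[OF finite.emptyI] empty_iff not_False_eq_True sum.empty add_0_right)
      also have "\<dots> \<le> (\<Sum>i. ennreal (c i) * indicator (E i) x)"
        by (rule sum_le_suminf) auto
      finally show ?thesis .
    next
      \<comment> \<open>At the origin \<open>0 powr (- \<gamma>)\<close> is 0, so the integrand
        vanishes; outside the interval the indicator does.\<close>
      case False
      then show ?thesis by (auto simp: U_op_def indicator_def)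
    qed
    have "(\<integral>\<^sup>+x. ennreal (\<bar>U_op \<gamma> (trig_sum a b) x\<bar> powr p) \<partial>lebesgue_on {-pi..pi})
        = (\<integral>\<^sup>+x. ennreal (\<bar>U_op \<gamma> (trig_sum a b) x\<bar> powr p) * indicator {-pi..pi} x \<partial>lebesgue)"
      by (rule nn_integral_restrict_space) simp
    also have "\<dots> \<le> (\<integral>\<^sup>+x. (\<Sum>i. ennreal (c i) * indicator (E i) x) \<partial>lebesgue)"
      by (intro nn_integral_mono pointwise)
    also have "\<dots> = (\<Sum>i. \<integral>\<^sup>+x. ennreal (c i) * indicator (E i) x \<partial>lebesgue)"
      using E by (intro nn_integral_suminf) auto
    also have "\<dots> = (\<Sum>i. ennreal (c i) * emeasure lebesgue (E i))"
      using E by (simp add: nn_integral_cmult_indicator)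
    also have "\<dots> \<le> (\<Sum>i. ennreal (c i) * ennreal (8 * pi * real (Suc i) powr (- 2)))"
      by (intro suminf_le mult_left_mono emeasure_E) auto
    also have "\<dots> = (\<Sum>i. ennreal D * ennreal (real (Suc i) powr (- (2 - \<gamma> * p)) * (\<Sum>m\<le>i. l m) powr p))"
    proof (intro arg_cong[where f = suminf] ext)
      fix i
      have "real (Suc i) powr (- (2 - \<gamma> * p)) = real (Suc i) powr (\<gamma> * p) * real (Suc i) powr (- 2)"
        by (simp flip: powr_add)
      then have "c i * (8 * pi * real (Suc i) powr (- 2))
          = D * (real (Suc i) powr (- (2 - \<gamma> * p)) * (\<Sum>m\<le>i. l m) powr p)"
        by (simp only: c_def D_def mult_ac)
      then show "ennreal (c i) * ennreal (8 * pi * real (Suc i) powr (- 2))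
          = ennreal D * ennreal (real (Suc i) powr (- (2 - \<gamma> * p)) * (\<Sum>m\<le>i. l m) powr p)"
        using D by (simp add: ennreal_mult'[symmetric] c_def)
    qed
    also have "\<dots> = ennreal D * (\<Sum>i. ennreal (real (Suc i) powr (- (2 - \<gamma> * p)) * (\<Sum>m\<le>i. l m) powr p))"
      by (rule ennreal_suminf_cmult)
    also have "\<dots> \<le> ennreal D * (ennreal H * (\<Sum>m. ennreal (real (Suc m) powr (p - (2 - \<gamma> * p)) * l m powr p)))"
      using l by (intro mult_left_mono H(2)) auto
    also have "\<dots> = ennreal (D * H) * (\<Sum>m. ennreal (real (Suc m) powr (p * (1 + \<gamma>) - 2) * \<bar>coeff_seq a b (Suc m)\<bar> powr p))"
    proof -
      have "p - (2 - \<gamma> * p) = p * (1 + \<gamma>) - 2" by (simp add: algebra_simps)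
      moreover have "\<bar>coeff_seq a b (Suc m)\<bar> = l m" for m using l[of m] by (simp add: l_def)
      ultimately show ?thesis using D H(1) by (simp only: ennreal_mult[OF less_imp_le less_imp_le] mult.assoc)
    qed
    finally show "(\<integral>\<^sup>+x. ennreal (\<bar>U_op \<gamma> (trig_sum a b) x\<bar> powr p) \<partial>lebesgue_on {-pi..pi})
        \<le> ennreal (D * H) * (\<Sum>m. ennreal (real (Suc m) powr (p * (1 + \<gamma>) - 2) * \<bar>coeff_seq a b (Suc m)\<bar> powr p))" .
  qed
qed

section \<open>Powers and quotients of extended nonnegative reals\<close>

lemma ennreal_powr_mono: "x \<le> y \<Longrightarrow> 0 \<le> r \<Longrightarrow> ennreal_powr x r \<le> ennreal_powr y r"
  by (auto simp: ennreal_powr_def top_unique less_top intro!: ennreal_leI powr_mono2 enn2real_mono)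

lemma ennreal_powr_inverse:
  assumes "0 < r"
  shows "ennreal_powr (ennreal_powr x r) (1 / r) = x"
  using assms by (cases x) (auto simp: ennreal_powr_def powr_powr)

lemma ennreal_powr_cmult:
  assumes "0 < c"
  shows "ennreal_powr (ennreal c * x) r = ennreal (c powr r) * ennreal_powr x r"
proof (cases x)
  case (real t)
  then show ?thesis using assms by (simp add: ennreal_powr_def powr_mult flip: ennreal_mult')
next
  case top
  then show ?thesis using assms by (simp add: ennreal_powr_def ennreal_mult_top)
qed

lemma ennreal_powr_eq_0_iff: "ennreal_powr x r = 0 \<longleftrightarrow> x = 0"
  by (cases x) (auto simp: ennreal_powr_def)

lemma ennreal_powr_less_top_iff: "ennreal_powr x r < \<infinity> \<longleftrightarrow> x < \<infinity>"
  by (cases x) (auto simp: ennreal_powr_def)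

lemma ennreal_divide_le_iff_le_mult:
  fixes x y z :: ennreal
  assumes "0 < y" "y < \<infinity>"
  shows "x / y \<le> z \<longleftrightarrow> x \<le> z * y"
proof
  assume "x / y \<le> z"
  then have "x / y * y \<le> z * y" by (rule mult_right_mono) simp
  then show "x \<le> z * y" using assms by (simp add: ennreal_divide_times ennreal_mult_divide_eq less_top)
next
  assume "x \<le> z * y"
  then have "x / y \<le> z * y / y" by (rule divide_right_mono_ennreal)
  then show "x / y \<le> z" using assms by (simp add: ennreal_mult_divide_eq less_top)
qed

section \<open>Weighted sequence norms and decay of the coefficients\<close>

lemma seq_norm_eq_0_iff: "seq_norm \<gamma> p l = 0 \<longleftrightarrow> (\<forall>n\<ge>1. l n = 0)"
proof -
  have "seq_norm \<gamma> p l = 0 \<longleftrightarrow> (\<forall>m. l (Suc m) = 0)"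
    unfolding seq_norm_def ennreal_powr_eq_0_iff
    by (subst suminf_eq_zero_iff) (auto simp: ennreal_eq_0_iff mult_le_0_iff)
  also have "\<dots> \<longleftrightarrow> (\<forall>n\<ge>1. l n = 0)"
    by (metis Suc_le_D Suc_le_mono One_nat_def zero_le)
  finally show ?thesis .
qed

text \<open>If |c| eventually stayed above some d > 0, the series would dominate a multiple of the
  harmonic series. So |c| is small arbitrarily far out, and monotonicity turns this into
  convergence.\<close>

lemma decseq_tendsto_0_if_summable:
  fixes c :: "nat \<Rightarrow> real"
  assumes dec: "decseq c" and p: "0 < p"
    and summ: "summable (\<lambda>k. \<bar>c k\<bar> powr p / real (Suc k))"
  shows "c \<longlonglongrightarrow> 0"
proof -
  have small: "\<exists>j\<ge>k. \<bar>c j\<bar> < d" if "0 < d" for d k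
  proof (rule ccontr)
    assume "\<not> ?thesis"
    then have ge: "\<And>j. k \<le> j \<Longrightarrow> d \<le> \<bar>c j\<bar>" by (auto simp: not_less)
    have "summable (\<lambda>j. d powr p / real (Suc j))"
    proof (rule summable_comparison_test'[OF summ])
      fix j assume "k \<le> j"
      then show "norm (d powr p / real (Suc j)) \<le> \<bar>c j\<bar> powr p / real (Suc j)"
        using ge[of j] that p by (auto intro!: divide_right_mono powr_mono2)
    qed
    then have "summable (\<lambda>j. inverse (d powr p) * (d powr p / real (Suc j)))"
      by (rule summable_mult)
    then have "summable (\<lambda>j. inverse (real (Suc j)))"
      using that by (simp add: field_simps)
    then show False
      using not_summable_harmonic[where 'a = real] by (subst (asm) summable_Suc_iff) auto
  qed
  \<comment> \<open>By monotonicity a negative entry would keep all later entries away from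
    0.\<close>
  have nn: "0 \<le> c k" for k
  proof (rule ccontr)
    assume "\<not> 0 \<le> c k"
    then obtain j where "k \<le> j" "\<bar>c j\<bar> < - c k" using small[of "- c k" k] by auto
    then show False using decseqD[OF dec, of k j] by linarith
  qed
  show ?thesis
  proof (rule LIMSEQ_I)
    fix e :: real assume "0 < e"
    then obtain j where j: "\<bar>c j\<bar> < e" using small[of e 0] by auto
    have "norm (c n - 0) < e" if "j \<le> n" for n
      using decseqD[OF dec that] nn[of n] j by simp
    then show "\<exists>no. \<forall>n\<ge>no. norm (c n - 0) < e" by blast
  qed
qed

lemma summable_of_seq_norm:
  assumes "seq_norm \<gamma> p l < \<infinity>"
  shows "summable (\<lambda>m. real (Suc m) powr (p * (1 + \<gamma>) - 2) * \<bar>l (Suc m)\<bar> powr p)"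
  using assms unfolding seq_norm_def ennreal_powr_less_top_iff
  by (intro summable_suminf_not_top) (auto simp: less_top)

text \<open>The weight exponent p (1 + \<gamma>) - 2 is at least -1, so a finite norm gives the
  harmonic-weight summability of the preceding criterion for each of the two sequences.\<close>

lemma coeffs_tendsto_0:
  fixes \<gamma> p :: real
  assumes \<gamma>: "0 \<le> \<gamma>" and p: "1 \<le> p"
    and dec: "decreasing_coeffs a b" and fin: "seq_norm \<gamma> p (coeff_seq a b) < \<infinity>"
  shows "decseq a" "a \<longlonglongrightarrow> 0" "decseq (\<lambda>k. b (Suc k))" "(\<lambda>k. b (Suc k)) \<longlonglongrightarrow> 0"
proof -
  show a: "decseq a" using dec by (simp add: decreasing_coeffs_def)
  show b: "decseq (\<lambda>k. b (Suc k))"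
    using dec by (auto simp: decreasing_coeffs_def monotone_on_def)
  let ?h = "\<lambda>m. real (Suc m) powr (p * (1 + \<gamma>) - 2) * \<bar>coeff_seq a b (Suc m)\<bar> powr p"
  have h: "summable ?h" using summable_of_seq_norm[OF fin] .
  have "1 * 1 \<le> p * (1 + \<gamma>)" using p \<gamma> by (intro mult_mono) auto
  then have powr: "1 / (2 * real (Suc k)) \<le> real (Suc m) powr (p * (1 + \<gamma>) - 2)"
    if "Suc m \<le> 2 * Suc k" for m k
  proof -
    have "1 / (2 * real (Suc k)) \<le> 1 / real (Suc m)"
      using that by (intro divide_left_mono) auto
    also have "\<dots> = real (Suc m) powr (- 1)" by (simp add: powr_minus divide_inverse)
    also have "\<dots> \<le> real (Suc m) powr (p * (1 + \<gamma>) - 2)"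
      using \<open>1 * 1 \<le> p * (1 + \<gamma>)\<close> by (intro powr_mono) auto
    finally show ?thesis .
  qed
  \<comment> \<open>\<open>g\<close> lists, counting from 0, the positions of one sequence inside
    the combined one. The weight at position \<open>g k\<close> is at least 1 / (2 (k+1)), whence
    the factor 2 below.\<close>
  have sub: "c \<longlonglongrightarrow> 0" if c: "decseq c" and g: "strict_mono g"
      "\<And>k. Suc (g k) \<le> 2 * Suc k" "\<And>k. coeff_seq a b (Suc (g k)) = c k" for c g
  proof (rule decseq_tendsto_0_if_summable[OF c])
    show "0 < p" using p by simp
    have "summable (\<lambda>k. 2 * ?h (g k))"
      by (intro summable_mult) (use summable_reindex[OF h strict_mono_imp_inj_on[OF g(1)]] in \<open>simp add: o_def\<close>)
    then show "summable (\<lambda>k. \<bar>c k\<bar> powr p / real (Suc k))"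
    proof (rule summable_comparison_test'[where N = 0])
      fix k
      have "1 / (2 * real (Suc k)) * \<bar>c k\<bar> powr p \<le> ?h (g k)"
        unfolding g(3) using powr[OF g(2)] by (intro mult_right_mono) auto
      then have "2 * (1 / (2 * real (Suc k)) * \<bar>c k\<bar> powr p) \<le> 2 * ?h (g k)"
        by (rule mult_left_mono) simp
      moreover have "norm (\<bar>c k\<bar> powr p / real (Suc k)) = 2 * (1 / (2 * real (Suc k)) * \<bar>c k\<bar> powr p)"
        by (simp add: divide_simps)
      ultimately show "norm (\<bar>c k\<bar> powr p / real (Suc k)) \<le> 2 * ?h (g k)" by (simp only:)
    qed
  qed
  show "a \<longlonglongrightarrow> 0"
    by (rule sub[OF a, of "\<lambda>k. 2 * k"]) (auto simp: strict_mono_def coeff_seq_def)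
  show "(\<lambda>k. b (Suc k)) \<longlonglongrightarrow> 0"
    by (rule sub[OF b, of "\<lambda>k. 2 * k + 1"]) (auto simp: strict_mono_def coeff_seq_def)
qed

text \<open>The p-th root of the integral estimate; its convergence hypotheses follow from
  finiteness of the sequence norm.\<close>

lemma Lp_norm_U_op_le:
  fixes \<gamma> p :: real
  assumes \<gamma>: "0 < \<gamma>" and p: "1 < p" and \<gamma>p: "\<gamma> * p < 1"
  shows "\<exists>C. \<forall>a b. decreasing_coeffs a b \<longrightarrow> seq_norm \<gamma> p (coeff_seq a b) < \<infinity> \<longrightarrow>
      Lp_norm p (U_op \<gamma> (trig_sum a b)) \<le> ennreal C * seq_norm \<gamma> p (coeff_seq a b)"
proof -
  obtain C where C: "0 < C" "\<And>a b. decseq a \<Longrightarrow> a \<longlonglongrightarrow> 0 \<Longrightarrow>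
      decseq (\<lambda>k. b (Suc k)) \<Longrightarrow> (\<lambda>k. b (Suc k)) \<longlonglongrightarrow> 0 \<Longrightarrow>
      (\<integral>\<^sup>+x. ennreal (\<bar>U_op \<gamma> (trig_sum a b) x\<bar> powr p) \<partial>lebesgue_on {-pi..pi})
        \<le> ennreal C * (\<Sum>m. ennreal (real (Suc m) powr (p * (1 + \<gamma>) - 2) * \<bar>coeff_seq a b (Suc m)\<bar> powr p))"
    using integral_abs_U_op_powr_le[OF assms] by blast
  show ?thesis
  proof (intro exI allI impI)
    fix a b assume ab: "decreasing_coeffs a b" "seq_norm \<gamma> p (coeff_seq a b) < \<infinity>"
    have "0 \<le> \<gamma>" "1 \<le> p" using \<gamma> p by auto
    from C(2)[OF coeffs_tendsto_0[OF this ab]]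
    show "Lp_norm p (U_op \<gamma> (trig_sum a b)) \<le> ennreal (C powr (1 / p)) * seq_norm \<gamma> p (coeff_seq a b)"
      unfolding Lp_norm_def seq_norm_def ennreal_powr_cmult[OF C(1), symmetric]
      using p by (intro ennreal_powr_mono) auto
  qed
qed

lemma K_const_finite:
  fixes \<gamma> p :: real
  assumes "0 < \<gamma>" "1 < p" "\<gamma> * p < 1"
  shows "K_const \<gamma> p < \<infinity>"
proof -
  obtain C where C: "\<And>a b. decreasing_coeffs a b \<Longrightarrow> seq_norm \<gamma> p (coeff_seq a b) < \<infinity> \<Longrightarrow>
      Lp_norm p (U_op \<gamma> (trig_sum a b)) \<le> ennreal C * seq_norm \<gamma> p (coeff_seq a b)"
    using Lp_norm_U_op_le[OF assms] by blast
  have "K_const \<gamma> p \<le> ennreal C"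
    unfolding K_const_def
  proof (rule SUP_least, clarify)
    fix a b and n :: nat
    assume ab: "decreasing_coeffs a b" "seq_norm \<gamma> p (coeff_seq a b) < \<infinity>"
      and n: "1 \<le> n" "coeff_seq a b n \<noteq> 0"
    then have "seq_norm \<gamma> p (coeff_seq a b) \<noteq> 0" unfolding seq_norm_eq_0_iff by blast
    then show "Lp_norm p (U_op \<gamma> (trig_sum a b)) / seq_norm \<gamma> p (coeff_seq a b) \<le> ennreal C"
      using C[OF ab] ab(2) by (subst ennreal_divide_le_iff_le_mult) (auto simp: zero_less_iff_neq_zero)
  qed
  also have "\<dots> < \<infinity>" by simp
  finally show ?thesis .
qed

lemma Lp_norm_U_op_le_K_const:
  assumes ab: "decreasing_coeffs a b" "seq_norm \<gamma> p (coeff_seq a b) < \<infinity>"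
    and nz: "\<exists>n\<ge>1. coeff_seq a b n \<noteq> 0"
  shows "Lp_norm p (U_op \<gamma> (trig_sum a b)) \<le> K_const \<gamma> p * seq_norm \<gamma> p (coeff_seq a b)"
proof -
  have "Lp_norm p (U_op \<gamma> (trig_sum a b)) / seq_norm \<gamma> p (coeff_seq a b) \<le> K_const \<gamma> p"
    unfolding K_const_def by (rule SUP_upper2[of "(a, b)"]) (use assms in auto)
  moreover have "seq_norm \<gamma> p (coeff_seq a b) \<noteq> 0" using nz unfolding seq_norm_eq_0_iff by blast
  ultimately show ?thesis
    using ab(2) by (subst (asm) ennreal_divide_le_iff_le_mult) (auto simp: zero_less_iff_neq_zero)
qed

section \<open>Reduction to finitely supported coefficients\<close>

text \<open>Applied to a and b with the same N, this keeps the entries 1, ..., 2N+1 of the combined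
  sequence and turns the series into its N-th partial sum.\<close>

definition truncate_seq :: "nat \<Rightarrow> (nat \<Rightarrow> real) \<Rightarrow> nat \<Rightarrow> real" where
  "truncate_seq N c k = (if k \<le> N then c k else 0)"

lemma coeff_seq_truncate_seq:
  "coeff_seq (truncate_seq N a) (truncate_seq N b) n = (if n div 2 \<le> N then coeff_seq a b n else 0)"
  by (simp add: coeff_seq_def truncate_seq_def)

text \<open>Nonnegativity makes the drop to 0 at the cut a decrease.\<close>

lemma decreasing_coeffs_truncate_seq:
  assumes a: "decseq a" "\<And>k. 0 \<le> a k" and b: "decseq (\<lambda>k. b (Suc k))" "\<And>k. 0 \<le> b (Suc k)"
  shows "decreasing_coeffs (truncate_seq N a) (truncate_seq N b)"
  unfolding decreasing_coeffs_def
proof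
  show "decseq (truncate_seq N a)"
    using a by (auto simp: decseq_def truncate_seq_def)
  show "antimono_on {1..} (truncate_seq N b)"
  proof (rule monotone_onI)
    fix i j :: nat assume "i \<in> {1..}" "j \<in> {1..}" "i \<le> j"
    then obtain i' j' where "i = Suc i'" "j = Suc j'" "i' \<le> j'" by (cases i; cases j) auto
    then show "truncate_seq N b j \<le> truncate_seq N b i"
      using decseqD[OF b(1), of i' j'] b(2)[of i'] by (auto simp: truncate_seq_def)
  qed
qed

lemma seq_norm_truncate_seq_le:
  assumes "0 < p"
  shows "seq_norm \<gamma> p (coeff_seq (truncate_seq N a) (truncate_seq N b)) \<le> seq_norm \<gamma> p (coeff_seq a b)"
  unfolding seq_norm_def using assms
  by (intro ennreal_powr_mono suminf_le ennreal_leI mult_left_mono)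
    (auto simp: coeff_seq_truncate_seq)

lemma trig_sum_truncate_seq:
  "trig_sum (truncate_seq N a) (truncate_seq N b) x =
    a 0 / 2 + (\<Sum>k<N. a (Suc k) * cos (real (Suc k) * x) + b (Suc k) * sin (real (Suc k) * x))"
  unfolding trig_sum_def by (subst suminf_finite[of "{..<N}"]) (auto simp: truncate_seq_def)

lemma ennreal_powr_inverse_le_iff:
  assumes "0 < p"
  shows "ennreal_powr x (1 / p) \<le> y \<longleftrightarrow> x \<le> ennreal_powr y p"
proof
  assume "ennreal_powr x (1 / p) \<le> y"
  then have "ennreal_powr (ennreal_powr x (1 / p)) p \<le> ennreal_powr y p"
    using assms by (intro ennreal_powr_mono) auto
  then show "x \<le> ennreal_powr y p"
    using ennreal_powr_inverse[of "1 / p" x] assms by simp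
next
  assume "x \<le> ennreal_powr y p"
  then have "ennreal_powr x (1 / p) \<le> ennreal_powr (ennreal_powr y p) (1 / p)"
    using assms by (intro ennreal_powr_mono) auto
  then show "ennreal_powr x (1 / p) \<le> y"
    using ennreal_powr_inverse[of p y] assms by simp
qed

text \<open>The partial sums converge pointwise, so Fatou's lemma carries a uniform bound over to
  the limit.\<close>

lemma Lp_norm_le_of_truncations:
  fixes \<gamma> p :: real
  assumes p: "0 < p"
    and a: "decseq a" "a \<longlonglongrightarrow> 0"
    and b: "decseq (\<lambda>k. b (Suc k))" "(\<lambda>k. b (Suc k)) \<longlonglongrightarrow> 0"
    and le: "\<And>N. 1 \<le> N \<Longrightarrow> Lp_norm p (U_op \<gamma> (trig_sum (truncate_seq N a) (truncate_seq N b))) \<le> M"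
  shows "Lp_norm p (U_op \<gamma> (trig_sum a b)) \<le> M"
proof -
  let ?L = "lebesgue_on {-pi..pi}"
  define t where "t = (\<lambda>N. trig_sum (truncate_seq N a) (truncate_seq N b))"
  define u where "u = (\<lambda>N x. ennreal (\<bar>U_op \<gamma> (t N) x\<bar> powr p))"
  have lim: "(\<lambda>N. u N x) \<longlonglongrightarrow> ennreal (\<bar>U_op \<gamma> (trig_sum a b) x\<bar> powr p)" if "x \<in> {-pi..pi}" for x
  \<comment> \<open>At the origin both sides are 0 because \<open>0 powr (- \<gamma>)\<close> is 0;
    elsewhere the series converges.\<close>
  proof (cases "x = 0")
    case False
    then have "x \<noteq> 0" "\<bar>x\<bar> \<le> pi" using that by auto
    from sums_summable[OF trig_series_eq_cis[OF a b this]]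
    have "(\<lambda>N. t N x) \<longlonglongrightarrow> trig_sum a b x"
      unfolding t_def trig_sum_truncate_seq unfolding trig_sum_def
      by (intro tendsto_intros summable_LIMSEQ) auto
    then have "(\<lambda>N. \<bar>U_op \<gamma> (t N) x\<bar>) \<longlonglongrightarrow> \<bar>U_op \<gamma> (trig_sum a b) x\<bar>"
      unfolding U_op_def by (intro tendsto_intros)
    then show ?thesis
      unfolding u_def using p by (intro tendsto_ennrealI tendsto_powr') auto
  qed (simp add: u_def U_op_def)
  have meas: "u N \<in> borel_measurable ?L" for N
  proof -
    have "u N \<in> borel_measurable lborel"
      unfolding u_def t_def U_op_def trig_sum_truncate_seq by measurable
    then show ?thesis by (intro measurable_restrict_space1 measurable_completion)
  qed
  have "(\<integral>\<^sup>+x. ennreal (\<bar>U_op \<gamma> (trig_sum a b) x\<bar> powr p) \<partial>?L) = (\<integral>\<^sup>+x. liminf (\<lambda>N. u N x) \<partial>?L)"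
  proof (rule nn_integral_cong)
    fix x assume "x \<in> space ?L"
    then have "(\<lambda>N. u N x) \<longlonglongrightarrow> ennreal (\<bar>U_op \<gamma> (trig_sum a b) x\<bar> powr p)"
      by (intro lim) simp
    then show "ennreal (\<bar>U_op \<gamma> (trig_sum a b) x\<bar> powr p) = liminf (\<lambda>N. u N x)"
      by (simp add: lim_imp_Liminf)
  qed
  also have "\<dots> \<le> liminf (\<lambda>N. \<integral>\<^sup>+x. u N x \<partial>?L)"
    by (rule nn_integral_liminf[OF meas])
  also have "\<dots> \<le> limsup (\<lambda>N. \<integral>\<^sup>+x. u N x \<partial>?L)"
    by (rule Liminf_le_Limsup) simp
  also have "\<dots> \<le> ennreal_powr M p"
  proof (rule Limsup_bounded)
    show "\<forall>\<^sub>F N in sequentially. (\<integral>\<^sup>+x. u N x \<partial>?L) \<le> ennreal_powr M p"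
      using eventually_ge_at_top[of 1]
    proof eventually_elim
      case (elim N)
      from le[OF elim] show ?case
        unfolding Lp_norm_def ennreal_powr_inverse_le_iff[OF p] u_def t_def .
    qed
  qed
  finally show ?thesis
    unfolding Lp_norm_def ennreal_powr_inverse_le_iff[OF p] .
qed

text \<open>The witness is a(0) = 1 with all other coefficients 0: its norm is 1, its sum is the
  constant 1/2, and |x|^(-\<gamma>) / 2 is bounded below by a positive constant on [1, pi].\<close>

lemma K_const_pos:
  fixes \<gamma> p :: real
  assumes \<gamma>: "0 \<le> \<gamma>" and p: "0 < p"
  shows "0 < K_const \<gamma> p"
proof -
  define a where "a = (\<lambda>k::nat. if k = 0 then 1 else 0 :: real)"
  define b where "b = (\<lambda>k::nat. 0 :: real)"
  have c: "coeff_seq a b (Suc m) = (if m = 0 then 1 else 0)" for m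
    by (auto simp: coeff_seq_def a_def b_def elim: oddE)
  have "seq_norm \<gamma> p (coeff_seq a b) = ennreal_powr (\<Sum>m\<in>{0}. ennreal (real (Suc m) powr (p * (1 + \<gamma>) - 2) * \<bar>coeff_seq a b (Suc m)\<bar> powr p)) (1 / p)"
    unfolding seq_norm_def using p by (subst suminf_finite[of "{0}"]) (auto simp: c)
  then have norm: "seq_norm \<gamma> p (coeff_seq a b) = 1"
    using p by (simp add: c ennreal_powr_def)
  have dec: "decreasing_coeffs a b"
    by (auto simp: decreasing_coeffs_def decseq_def monotone_on_def a_def b_def)
  have f: "trig_sum a b x = 1 / 2" for x by (simp add: trig_sum_def a_def b_def)
  have Lp: "Lp_norm p (U_op \<gamma> (trig_sum a b)) \<noteq> 0"
  proof
    assume "Lp_norm p (U_op \<gamma> (trig_sum a b)) = 0"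
    then have "(\<integral>\<^sup>+x. ennreal (\<bar>U_op \<gamma> (trig_sum a b) x\<bar> powr p) \<partial>lebesgue_on {-pi..pi}) = 0"
      by (simp add: Lp_norm_def ennreal_powr_eq_0_iff)
    moreover have "(\<integral>\<^sup>+x. ennreal ((pi powr - \<gamma> / 2) powr p) * indicator {1..pi} x \<partial>lebesgue)
        \<le> (\<integral>\<^sup>+x. ennreal (\<bar>U_op \<gamma> (trig_sum a b) x\<bar> powr p) * indicator {-pi..pi} x \<partial>lebesgue)"
    proof (rule nn_integral_mono)
      fix x :: real
      show "ennreal ((pi powr - \<gamma> / 2) powr p) * indicator {1..pi} x
        \<le> ennreal (\<bar>U_op \<gamma> (trig_sum a b) x\<bar> powr p) * indicator {-pi..pi} x"
      proof (cases "x \<in> {1..pi}")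
        case True
        then have "pi powr - \<gamma> \<le> x powr - \<gamma>" using \<gamma> by (intro powr_mono2') auto
        then have "(pi powr - \<gamma> / 2) powr p \<le> \<bar>U_op \<gamma> (trig_sum a b) x\<bar> powr p"
          using True p by (intro powr_mono2) (auto simp: U_op_def f abs_mult)
        then show ?thesis using True by (auto simp: indicator_def ennreal_leI)
      qed simp
    qed
    moreover have "(\<integral>\<^sup>+x. ennreal (\<bar>U_op \<gamma> (trig_sum a b) x\<bar> powr p) * indicator {-pi..pi} x \<partial>lebesgue)
        = (\<integral>\<^sup>+x. ennreal (\<bar>U_op \<gamma> (trig_sum a b) x\<bar> powr p) \<partial>lebesgue_on {-pi..pi})"
      by (rule nn_integral_restrict_space[symmetric]) simp
    ultimately have "ennreal ((pi powr - \<gamma> / 2) powr p) * emeasure lebesgue {1..pi} = 0"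
      by (simp add: nn_integral_cmult_indicator)
    then show False using pi_gt3 by (simp add: ennreal_eq_0_iff)
  qed
  have "Lp_norm p (U_op \<gamma> (trig_sum a b)) / seq_norm \<gamma> p (coeff_seq a b) \<le> K_const \<gamma> p"
    unfolding K_const_def using dec norm c[of 0]
    by (intro SUP_upper2[of "(a, b)"]) (auto intro!: exI[of _ 1])
  then show ?thesis
    using Lp norm by (auto simp: zero_less_iff_neq_zero)
qed

text \<open>For finite support the norm is a root of a finite sum of exponentials in p, hence
  continuous and positive. Continuity on the closed interval gives a positive minimum, hence a
  positive infimum on the open one.\<close>

lemma seq_norm_in_Psi_class:
  fixes \<gamma> p0 :: real
  assumes p0: "1 < p0" and fin: "\<And>n. M < n \<Longrightarrow> l n = 0" and nz: "\<exists>n\<ge>1. l n \<noteq> 0"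
  shows "\<exists>\<psi>\<in>Psi_class p0. \<forall>p>0. seq_norm \<gamma> p l = ennreal (\<psi> p)"
proof -
  define S where "S = (\<lambda>p. \<Sum>m<M. real (Suc m) powr (p * (1 + \<gamma>) - 2) * \<bar>l (Suc m)\<bar> powr p)"
  define \<psi> where "\<psi> = (\<lambda>p. S p powr (1 / p))"
  obtain n where n: "1 \<le> n" "l n \<noteq> 0" using nz by blast
  then have "n \<le> M" using fin[of n] by (meson not_le)
  with n have nM: "n - 1 < M" "Suc (n - 1) = n" by auto
  have S_pos: "0 < S p" for p
    unfolding S_def using n nM by (intro sum_pos2[of _ "n - 1"]) auto
  have S_cont: "continuous_on A S" for A
    unfolding S_def
  proof (intro continuous_on_sum continuous_on_mult)
    fix m
    show "continuous_on A (\<lambda>p. real (Suc m) powr (p * (1 + \<gamma>) - 2))"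
      by (intro continuous_intros) auto
    show "continuous_on A (\<lambda>p. \<bar>l (Suc m)\<bar> powr p)"
      \<comment> \<open>For a zero entry the function is constantly 0, since \<open>0 powr p\<close>
        is 0 for every p.\<close>
      by (cases "l (Suc m) = 0") (auto intro!: continuous_intros)
  qed
  have cont: "continuous_on {1..p0} \<psi>"
    unfolding \<psi>_def
  proof (rule continuous_on_powr[OF S_cont])
    show "continuous_on {1..p0} ((/) 1)" by (intro continuous_intros) auto
    show "\<forall>p\<in>{1..p0}. S p \<noteq> 0" using S_pos by (metis less_irrefl)
  qed
  have pos: "0 < \<psi> p" for p using S_pos[of p] by (simp add: \<psi>_def)
  obtain q where q: "\<forall>p\<in>{1..p0}. \<psi> q \<le> \<psi> p"
    using continuous_attains_inf[OF _ _ cont] p0 by auto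
  have "\<psi> q \<le> (INF p\<in>{1<..<p0}. \<psi> p)"
    using p0 q by (intro cINF_greatest) auto
  with pos[of q] have "0 < (INF p\<in>{1<..<p0}. \<psi> p)" by linarith
  moreover have "continuous_on {1<..<p0} \<psi>"
    by (rule continuous_on_subset[OF cont]) auto
  ultimately have "\<psi> \<in> Psi_class p0" using pos by (simp add: Psi_class_def)
  moreover have "seq_norm \<gamma> p l = ennreal (\<psi> p)" if "0 < p" for p
  proof -
    have "(\<Sum>m. ennreal (real (Suc m) powr (p * (1 + \<gamma>) - 2) * \<bar>l (Suc m)\<bar> powr p))
        = (\<Sum>m<M. ennreal (real (Suc m) powr (p * (1 + \<gamma>) - 2) * \<bar>l (Suc m)\<bar> powr p))"
      using fin by (intro suminf_finite) auto
    also have "\<dots> = ennreal (S p)" unfolding S_def by (intro sum_ennreal) auto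
    finally show ?thesis
      using S_pos[of p] by (simp add: seq_norm_def \<psi>_def ennreal_powr_def)
  qed
  ultimately show ?thesis by blast
qed

section \<open>The inequality between the grand norms and its sharpness\<close>

lemma Lp_norm_U_op_eq_0:
  assumes "\<forall>n\<ge>1. coeff_seq a b n = 0"
  shows "Lp_norm p (U_op \<gamma> (trig_sum a b)) = 0"
proof -
  have "a k = 0" "b (Suc k) = 0" for k
    using assms[rule_format, of "2 * k + 1"] assms[rule_format, of "2 * Suc k"]
    by (auto simp: coeff_seq_def)
  then have "U_op \<gamma> (trig_sum a b) = (\<lambda>x. 0)" by (simp add: U_op_def trig_sum_def fun_eq_iff)
  then show ?thesis by (simp add: Lp_norm_def ennreal_powr_def)
qed

lemma grand_norm_U_op_le:
  fixes \<gamma> p0 :: real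
  assumes \<gamma>: "0 < \<gamma>" and p0: "p0 = 1 / \<gamma>" and \<psi>: "\<psi> \<in> Psi_class p0"
    and dec: "decreasing_coeffs a b" and fin: "grand_seq_norm p0 \<gamma> \<psi> (coeff_seq a b) < \<infinity>"
  shows "grand_norm p0 (psi_gamma \<gamma> \<psi>) (U_op \<gamma> (trig_sum a b)) \<le> grand_seq_norm p0 \<gamma> \<psi> (coeff_seq a b)"
proof (cases "\<exists>n\<ge>1. coeff_seq a b n \<noteq> 0")
  \<comment> \<open>The zero sequence is outside the supremum defining \<open>K_const\<close>, so it
    is treated directly: its sum vanishes.\<close>
  case False
  then have "Lp_norm p (U_op \<gamma> (trig_sum a b)) = 0" for p
    by (intro Lp_norm_U_op_eq_0) auto
  then show ?thesis unfolding grand_norm_def by (intro SUP_least) simp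
next
  case True
  show ?thesis
    unfolding grand_norm_def grand_seq_norm_def
  proof (rule SUP_mono, rule bexI)
    fix p assume p: "p \<in> {1<..<p0}"
    then have "\<gamma> * p < 1" using \<gamma> p0 by (simp add: field_simps)
    then have K: "0 < K_const \<gamma> p" "K_const \<gamma> p < \<infinity>"
      using \<gamma> p by (auto intro!: K_const_pos K_const_finite simp del: infinity_ennreal_def)
    have \<psi>p: "0 < ennreal (\<psi> p)" "ennreal (\<psi> p) < \<infinity>"
      using \<psi> p by (auto simp: Psi_class_def)
    let ?s = "seq_norm \<gamma> p (coeff_seq a b)"
    have "?s / ennreal (\<psi> p) \<le> grand_seq_norm p0 \<gamma> \<psi> (coeff_seq a b)"
      unfolding grand_seq_norm_def using p by (rule SUP_upper)
    then have "?s \<le> grand_seq_norm p0 \<gamma> \<psi> (coeff_seq a b) * ennreal (\<psi> p)"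
      by (simp only: ennreal_divide_le_iff_le_mult[OF \<psi>p])
    also have "\<dots> < \<infinity>" using fin by (simp add: ennreal_mult_less_top)
    finally have "Lp_norm p (U_op \<gamma> (trig_sum a b)) \<le> K_const \<gamma> p * ?s"
      using dec True by (intro Lp_norm_U_op_le_K_const)
    \<comment> \<open>Dividing and multiplying by \<psi>(p) makes the denominator
      \<open>psi_gamma\<close> appear.\<close>
    also have "?s = ?s / ennreal (\<psi> p) * ennreal (\<psi> p)"
      using \<psi>p by (simp add: ennreal_divide_times ennreal_mult_divide_eq)
    finally have "Lp_norm p (U_op \<gamma> (trig_sum a b)) \<le> ?s / ennreal (\<psi> p) * (K_const \<gamma> p * ennreal (\<psi> p))"
      by (simp only: mult_ac)
    moreover have "0 < K_const \<gamma> p * ennreal (\<psi> p)" "K_const \<gamma> p * ennreal (\<psi> p) < \<infinity>"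
      using K \<psi>p by (auto simp: ennreal_zero_less_mult_iff ennreal_mult_less_top)
    ultimately show "Lp_norm p (U_op \<gamma> (trig_sum a b)) / psi_gamma \<gamma> \<psi> p \<le> ?s / ennreal (\<psi> p)"
      unfolding psi_gamma_def by (subst ennreal_divide_le_iff_le_mult)
  qed
qed

text \<open>Truncation does not increase the sequence norm, so a bound for all truncations passes to
  the original coefficients by Fatou's lemma.\<close>

lemma K_const_le_of_finitely_supported:
  fixes \<gamma> p :: real
  assumes \<gamma>: "0 \<le> \<gamma>" and p: "1 \<le> p"
    and le: "\<And>a b M. decreasing_coeffs a b \<Longrightarrow> \<exists>n\<ge>1. coeff_seq a b n \<noteq> 0 \<Longrightarrow>
      (\<And>n. M < n \<Longrightarrow> coeff_seq a b n = 0) \<Longrightarrow>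
      Lp_norm p (U_op \<gamma> (trig_sum a b)) \<le> R * seq_norm \<gamma> p (coeff_seq a b)"
  shows "K_const \<gamma> p \<le> R"
  unfolding K_const_def
proof (rule SUP_least, clarify)
  fix a b and n :: nat
  assume ab: "decreasing_coeffs a b" "seq_norm \<gamma> p (coeff_seq a b) < \<infinity>"
    and n: "1 \<le> n" "coeff_seq a b n \<noteq> 0"
  note lim = coeffs_tendsto_0[OF \<gamma> p ab]
  let ?s = "seq_norm \<gamma> p (coeff_seq a b)"
  have a: "a k \<le> a 0" "0 \<le> a k" and b: "b (Suc k) \<le> b 1" "0 \<le> b (Suc k)" for k
    using decseqD[OF lim(1), of 0 k] decseqD[OF lim(3), of 0 k] decseq_ge[OF lim(1,2)] decseq_ge[OF lim(3,4)]
    by auto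
  \<comment> \<open>Nonnegative decreasing sequences vanish entirely once their first entries
    do.\<close>
  have first: "a 0 \<noteq> 0 \<or> b 1 \<noteq> 0"
  proof (rule ccontr)
    assume "\<not> ?thesis"
    then have "a k = 0" "b (Suc k) = 0" for k using a[of k] b[of k] by auto
    then have "coeff_seq a b n = 0"
      using n(1) by (cases "n div 2") (auto simp: coeff_seq_def elim: evenE)
    then show False using n(2) by simp
  qed
  have "Lp_norm p (U_op \<gamma> (trig_sum a b)) \<le> R * ?s"
  proof (rule Lp_norm_le_of_truncations[OF _ lim])
    show "0 < p" using p by simp
    fix N :: nat assume N: "1 \<le> N"
    let ?a = "truncate_seq N a" and ?b = "truncate_seq N b"
    have "Lp_norm p (U_op \<gamma> (trig_sum ?a ?b)) \<le> R * seq_norm \<gamma> p (coeff_seq ?a ?b)"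
    proof (rule le)
      show "decreasing_coeffs ?a ?b"
        by (rule decreasing_coeffs_truncate_seq[OF lim(1) a(2) lim(3) b(2)])
      \<comment> \<open>Both a(0) and b(1) survive the cut because N is at least 1; at N = 0 the
        entry b(1) would be lost.\<close>
      have "coeff_seq ?a ?b 1 \<noteq> 0 \<or> coeff_seq ?a ?b 2 \<noteq> 0"
        using first N by (simp add: coeff_seq_truncate_seq) (simp add: coeff_seq_def)
      then show "\<exists>n\<ge>1. coeff_seq ?a ?b n \<noteq> 0"
        by (metis one_le_numeral order_refl)
      show "coeff_seq ?a ?b n = 0" if "2 * N + 1 < n" for n
        using that by (simp add: coeff_seq_truncate_seq)
    qed
    also have "\<dots> \<le> R * ?s"
      using p by (intro mult_left_mono seq_norm_truncate_seq_le) auto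
    finally show "Lp_norm p (U_op \<gamma> (trig_sum ?a ?b)) \<le> R * ?s" .
  qed
  moreover have "0 < ?s" using n seq_norm_eq_0_iff[of \<gamma> p "coeff_seq a b"] by (auto simp: zero_less_iff_neq_zero)
  ultimately show "Lp_norm p (U_op \<gamma> (trig_sum a b)) / ?s \<le> R"
    using ab(2) by (subst ennreal_divide_le_iff_le_mult)
qed

theorem mainTheorem8:
  fixes \<gamma> p0 :: real
  assumes "0 < \<gamma>" and "\<gamma> < 1" and "p0 = 1 / \<gamma>"
  shows "(\<forall>\<psi>\<in>Psi_class p0. \<forall>a b.
            decreasing_coeffs a b \<longrightarrow> grand_seq_norm p0 \<gamma> \<psi> (coeff_seq a b) < \<infinity> \<longrightarrow>
            grand_norm p0 (psi_gamma \<gamma> \<psi>) (U_op \<gamma> (trig_sum a b))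
              \<le> 1 * grand_seq_norm p0 \<gamma> \<psi> (coeff_seq a b))
       \<and> (SUP (\<psi>, a, b) \<in> {(\<psi>, a, b). \<psi> \<in> Psi_class p0 \<and> decreasing_coeffs a b \<and>
              (\<exists>n\<ge>1. coeff_seq a b n \<noteq> 0) \<and>
              grand_seq_norm p0 \<gamma> \<psi> (coeff_seq a b) < \<infinity>}.
            grand_norm p0 (psi_gamma \<gamma> \<psi>) (U_op \<gamma> (trig_sum a b))
              / grand_seq_norm p0 \<gamma> \<psi> (coeff_seq a b)) = 1"
    (is "?bound \<and> ?S = 1")
proof
  show ?bound using grand_norm_U_op_le[OF assms(1,3)] by simp
  have p0: "1 < p0" using assms by simp
  \<comment> \<open>Any fixed exponent in (1, p0) would serve; the midpoint is one choice.\<close>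
  define q where "q = (1 + p0) / 2"
  have q: "1 < q" "q < p0" using p0 by (simp_all add: q_def)
  then have "\<gamma> * q < 1" using assms by (simp add: field_simps)
  then have K: "0 < K_const \<gamma> q" "K_const \<gamma> q < \<infinity>"
    using assms q by (auto intro!: K_const_pos K_const_finite simp del: infinity_ennreal_def)
  show "?S = 1"
  proof (rule antisym)
    show "?S \<le> 1"
    proof (rule SUP_least, clarify)
      fix \<psi> a b and n :: nat
      assume \<psi>: "\<psi> \<in> Psi_class p0" and ab: "decreasing_coeffs a b"
        and fin: "grand_seq_norm p0 \<gamma> \<psi> (coeff_seq a b) < \<infinity>"
        and n: "1 \<le> n" "coeff_seq a b n \<noteq> 0"
      \<comment> \<open>The norm at the single exponent q shows that the denominator of the ratio is
        positive.\<close>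
      have "seq_norm \<gamma> q (coeff_seq a b) \<noteq> 0" using n seq_norm_eq_0_iff by blast
      then have "0 < seq_norm \<gamma> q (coeff_seq a b) / ennreal (\<psi> q)"
        by (simp add: ennreal_zero_less_divide zero_less_iff_neq_zero)
      also have "\<dots> \<le> grand_seq_norm p0 \<gamma> \<psi> (coeff_seq a b)"
        unfolding grand_seq_norm_def using q by (intro SUP_upper) auto
      finally show "grand_norm p0 (psi_gamma \<gamma> \<psi>) (U_op \<gamma> (trig_sum a b))
          / grand_seq_norm p0 \<gamma> \<psi> (coeff_seq a b) \<le> 1"
        using grand_norm_U_op_le[OF assms(1,3) \<psi> ab fin] fin
        by (simp add: ennreal_divide_le_iff_le_mult)
    qed
    \<comment> \<open>This gives 1 <= \<open>?S\<close> after cancelling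
      \<open>K_const \<gamma> q\<close>, which is positive and finite. It suffices to test finitely
      supported coefficients.\<close>
    have "K_const \<gamma> q \<le> ?S * K_const \<gamma> q"
    proof (rule K_const_le_of_finitely_supported)
      show "0 \<le> \<gamma>" "1 \<le> q" using assms q by auto
      fix a b and M :: nat
      assume ab: "decreasing_coeffs a b" and nz: "\<exists>n\<ge>1. coeff_seq a b n \<noteq> 0"
        and fin: "\<And>n. M < n \<Longrightarrow> coeff_seq a b n = 0"
      \<comment> \<open>Taking \<open>\<psi>\<close> to be the norm of the sequence itself makes its grand norm equal to 1.\<close>
      obtain \<psi> where \<psi>: "\<psi> \<in> Psi_class p0" "\<And>p. 0 < p \<Longrightarrow> seq_norm \<gamma> p (coeff_seq a b) = ennreal (\<psi> p)"
        using seq_norm_in_Psi_class[OF p0 fin nz] by blast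
      have \<psi>_pos: "0 < \<psi> p" if "p \<in> {1<..<p0}" for p
        using \<psi>(1) that by (auto simp: Psi_class_def)
      have "grand_seq_norm p0 \<gamma> \<psi> (coeff_seq a b) = (SUP p\<in>{1<..<p0}. 1)"
        unfolding grand_seq_norm_def
      proof (rule SUP_cong)
        fix p assume p: "p \<in> {1<..<p0}"
        then show "seq_norm \<gamma> p (coeff_seq a b) / ennreal (\<psi> p) = 1"
          using \<psi>_pos[OF p] \<psi>(2)[of p] by (simp add: ennreal_divide_self)
      qed simp
      also have "\<dots> = 1" using p0 by (intro cSUP_const) auto
      finally have grand: "grand_seq_norm p0 \<gamma> \<psi> (coeff_seq a b) = 1" .
      \<comment> \<open>The grand norm is bounded below by its quotient at the exponent q.\<close>
      have "Lp_norm q (U_op \<gamma> (trig_sum a b)) / (K_const \<gamma> q * ennreal (\<psi> q))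
          \<le> grand_norm p0 (psi_gamma \<gamma> \<psi>) (U_op \<gamma> (trig_sum a b))"
        unfolding grand_norm_def psi_gamma_def using q by (intro SUP_upper) auto
      also have "\<dots> = grand_norm p0 (psi_gamma \<gamma> \<psi>) (U_op \<gamma> (trig_sum a b))
          / grand_seq_norm p0 \<gamma> \<psi> (coeff_seq a b)"
        by (simp add: grand divide_ennreal_def)
      also have "\<dots> \<le> ?S"
        using \<psi>(1) ab nz grand by (intro SUP_upper2[of "(\<psi>, a, b)"]) auto
      finally have "Lp_norm q (U_op \<gamma> (trig_sum a b)) / (K_const \<gamma> q * ennreal (\<psi> q)) \<le> ?S" .
      moreover have "0 < K_const \<gamma> q * ennreal (\<psi> q)" "K_const \<gamma> q * ennreal (\<psi> q) < \<infinity>"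
        using K \<psi>_pos[of q] q by (auto simp: ennreal_zero_less_mult_iff ennreal_mult_less_top)
      ultimately have "Lp_norm q (U_op \<gamma> (trig_sum a b)) \<le> ?S * (K_const \<gamma> q * ennreal (\<psi> q))"
        by (simp only: ennreal_divide_le_iff_le_mult)
      then show "Lp_norm q (U_op \<gamma> (trig_sum a b)) \<le> ?S * K_const \<gamma> q * seq_norm \<gamma> q (coeff_seq a b)"
        using \<psi>(2)[of q] q by (simp add: mult.assoc)
    qed
    then have "K_const \<gamma> q / K_const \<gamma> q \<le> ?S"
      using K by (subst ennreal_divide_le_iff_le_mult)
    then show "1 \<le> ?S"
      using K by (simp add: ennreal_divide_self)
  qed
qed

end
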